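(* Let $k\ge2$ and for $n\ge0$ let $ud(n)$ be the number of up-down permutations of length $n$ that contain $1\mbox{-}3\mbox{-}2$ exactly once and contain $1\mbox{-}2\mbox{-}\cdots\mbox{-}k$ exactly once. Writing $U_r$ for $U_r\!\left(\frac1{2x}\right)$, $$\sum_{n\ge0}ud(n)x^n=\frac{1}{U_{k-1}^2}\sum_{j=0}^{k-3}\frac{U_{j+1}\bigl(U_{j+1}+xU_j\bigr)+2x\sum_{i=0}^{j-1}U_iU_{i+1}}{U_{j+1}U_{j+2}}.$$
   Context: A permutation of length $n$ is a word $\pi_1\cdots\pi_n$ containing each of $1,\dots,n$ exactly once. A classical pattern $\tau$ of length $m$ (written with dashes) occurs in $\pi$ at indices $i_1<\dots<i_m$ if $\pi_{i_1}\cdots\pi_{i_m}$ is order-isomorphic to $\tau$; containing $\tau$ exactly once means there is exactly one such index tuple. $1\mbox{-}3\mbox{-}2$ is the pattern $132$ and $1\mbox{-}2\mbox{-}\cdots\mbox{-}k$ is $12\cdots k$. An up-down permutation is one of odd length $n\ge3$ with $\pi_1<\pi_2>\pi_3<\cdots>\pi_n$; there are none of length $0$, $1$ or of even length. $U_r$ is the Chebyshev polynomial of the second kind, $U_r(\cos\theta)=\sin((r+1)\theta)/\sin\theta$; $U_0=1$, $U_1(t)=2t$, $U_r(t)=2tU_{r-1}(t)-U_{r-2}(t)$. An empty sum equals $0$. *)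

theory Defs
  imports
    "HOL-Computational_Algebra.Formal_Laurent_Series"
    "HOL-Computational_Algebra.Polynomial"
    "HOL-Combinatorics.Multiset_Permutations"
begin

text \<open>
  A permutation of length n is an element of \<^term>\<open>permutations_of_set {1..n}\<close>.
  List positions are 0-based, so the position i of the list is the index i + 1 of the word.
\<close>

definition occurrences :: "nat list \<Rightarrow> nat list \<Rightarrow> nat list set" where
  "occurrences \<tau> \<pi> =
     {is. length is = length \<tau> \<and> sorted_wrt (<) is \<and> set is \<subseteq> {..<length \<pi>} \<and>
          (\<forall>a<length \<tau>. \<forall>b<length \<tau>. \<pi> ! (is ! a) < \<pi> ! (is ! b) \<longleftrightarrow> \<tau> ! a < \<tau> ! b)}"

definition contains_once :: "nat list \<Rightarrow> nat list \<Rightarrow> bool" where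
  "contains_once \<tau> \<pi> \<longleftrightarrow> card (occurrences \<tau> \<pi>) = 1"

definition up_down :: "nat list \<Rightarrow> bool" where
  "up_down \<pi> \<longleftrightarrow>
     odd (length \<pi>) \<and> length \<pi> \<ge> 3 \<and>
     (\<forall>i. i + 1 < length \<pi> \<longrightarrow>
        (if even i then \<pi> ! i < \<pi> ! (i + 1) else \<pi> ! i > \<pi> ! (i + 1)))"

definition ud :: "nat \<Rightarrow> nat \<Rightarrow> nat" where
  "ud k n = card {\<pi> \<in> permutations_of_set {1..n}.
     up_down \<pi> \<and> contains_once [1, 3, 2] \<pi> \<and> contains_once [1..<k + 1] \<pi>}"

fun chebyshev_U :: "nat \<Rightarrow> 'a::comm_ring_1 poly" where
  "chebyshev_U 0 = 1"
| "chebyshev_U (Suc 0) = [:0, 2:]"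
| "chebyshev_U (Suc (Suc r)) = [:0, 2:] * chebyshev_U (Suc r) - chebyshev_U r"

text \<open>
  The argument 1/(2x) has a pole at 0, so identities between power series in x and
  expressions in \<open>U\<^sub>r(1/(2x))\<close> are read in the field of formal Laurent series.
\<close>

definition U :: "nat \<Rightarrow> rat fls" where
  "U r = poly (chebyshev_U r) (1 / (2 * fls_X))"

end

theory Submission
  imports Defs
begin

text \<open>
  Cut an up-down permutation at its maximum, \<open>\<pi> = \<alpha> n \<beta>\<close>; both parts are again up-down or of
  length 1. If \<open>\<pi>\<close> has at most one occurrence of 132, then either every entry of \<open>\<alpha>\<close>
  exceeds every entry of \<open>\<beta>\<close>, and the occurrence lies inside \<open>\<alpha>\<close> or \<open>\<beta>\<close>; or there is exactly one
  pair \<open>a < b\<close> with \<open>a\<close> in \<open>\<alpha>\<close> and \<open>b\<close> in \<open>\<beta>\<close>, the occurrence is \<open>a n b\<close>, and both parts avoid 132.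
  In the second case the value sets of \<open>\<alpha>\<close> and \<open>\<beta>\<close> are forced by their lengths, and no further
  occurrence arises because an up-down permutation avoiding 132 ends with its minimum. In both
  cases an increasing subsequence of length k (at least 3 in the second case) lies in \<open>\<beta>\<close> or in
  \<open>\<alpha> n\<close>. Let A, B, C, D be the generating functions of the permutations with
  (0,0), (0,1), (1,0), (1,1) occurrences of 132 and of 12...k; length 1 is admitted. Then
  \<open>A\<^sub>k = x + x A\<^sub>k\<^sub>-\<^sub>1 A\<^sub>k\<close>, \<open>B\<^sub>k = x (B\<^sub>k\<^sub>-\<^sub>1 A\<^sub>k + A\<^sub>k\<^sub>-\<^sub>1 B\<^sub>k)\<close>,
  \<open>C\<^sub>k = x (C\<^sub>k\<^sub>-\<^sub>1 A\<^sub>k + A\<^sub>k\<^sub>-\<^sub>1 C\<^sub>k + A\<^sub>k\<^sub>-\<^sub>1 A\<^sub>k)\<close> and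
  \<open>D\<^sub>k = x (D\<^sub>k\<^sub>-\<^sub>1 A\<^sub>k + B\<^sub>k\<^sub>-\<^sub>1 C\<^sub>k + C\<^sub>k\<^sub>-\<^sub>1 B\<^sub>k + A\<^sub>k\<^sub>-\<^sub>1 D\<^sub>k) + B\<^sub>k\<close>,
  the last two for \<open>k \<ge> 3\<close>, with \<open>C\<^sub>2 = D\<^sub>2 = 0\<close>. They are solved by
  \<open>A\<^sub>k = U\<^sub>k\<^sub>-\<^sub>2 / U\<^sub>k\<^sub>-\<^sub>1\<close>, \<open>B\<^sub>k = x / U\<^sub>k\<^sub>-\<^sub>1\<^sup>2\<close>, and sums divided by \<open>U\<^sub>k\<^sub>-\<^sub>1\<^sup>2\<close> for C and D.
\<close>

subsection \<open>Pattern occurrences as sets of values\<close>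

fun precedes :: "'a list \<Rightarrow> 'a \<Rightarrow> 'a \<Rightarrow> bool" where
  "precedes [] x y \<longleftrightarrow> False"
| "precedes (z # zs) x y \<longleftrightarrow> x = z \<and> y \<in> set zs \<or> precedes zs x y"

lemma precedes_in_set: "precedes xs x y \<Longrightarrow> x \<in> set xs \<and> y \<in> set xs"
  by (induction xs) auto

lemma precedes_append:
  "precedes (xs @ ys) x y \<longleftrightarrow> precedes xs x y \<or> precedes ys x y \<or> x \<in> set xs \<and> y \<in> set ys"
  by (induction xs) auto

lemma precedes_iff_nth:
  "precedes xs x y \<longleftrightarrow> (\<exists>i j. i < j \<and> j < length xs \<and> xs ! i = x \<and> xs ! j = y)"
proof (induction xs)
  case (Cons z zs)
  show ?case
  proof
    assume "precedes (z # zs) x y"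
    then consider "x = z" "y \<in> set zs" | "precedes zs x y" by auto
    then show "\<exists>i j. i < j \<and> j < length (z # zs) \<and> (z # zs) ! i = x \<and> (z # zs) ! j = y"
    proof cases
      case 1
      then obtain j where "j < length zs" "zs ! j = y" by (auto simp: in_set_conv_nth)
      with 1 show ?thesis by (intro exI[of _ 0] exI[of _ "Suc j"]) auto
    next
      case 2
      then obtain i j where "i < j" "j < length zs" "zs ! i = x" "zs ! j = y" using Cons by auto
      then show ?thesis by (intro exI[of _ "Suc i"] exI[of _ "Suc j"]) auto
    qed
  next
    assume "\<exists>i j. i < j \<and> j < length (z # zs) \<and> (z # zs) ! i = x \<and> (z # zs) ! j = y"
    then obtain i j where ij: "i < j" "j < length (z # zs)" "(z # zs) ! i = x" "(z # zs) ! j = y"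
      by blast
    then obtain j' where j': "j = Suc j'" by (cases j) auto
    show "precedes (z # zs) x y"
    proof (cases i)
      case 0
      with ij j' show ?thesis by auto
    next
      case (Suc i')
      with ij j' have "i' < j' \<and> j' < length zs \<and> zs ! i' = x \<and> zs ! j' = y" by auto
      then show ?thesis using Cons.IH by auto
    qed
  qed
qed simp

lemma precedes_map:
  "precedes (map f xs) u v \<longleftrightarrow> (\<exists>x y. precedes xs x y \<and> u = f x \<and> v = f y)"
  by (induction xs) auto

lemma precedes_antisym: "distinct xs \<Longrightarrow> precedes xs x y \<Longrightarrow> \<not> precedes xs y x"
  by (induction xs) (auto dest: precedes_in_set)

text \<open>Unlike \<^const>\<open>up_down\<close>, this admits length 1, so that both parts of a split qualify.\<close>

fun zigzag :: "nat list \<Rightarrow> bool" where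
  "zigzag [] \<longleftrightarrow> False"
| "zigzag [x] \<longleftrightarrow> True"
| "zigzag [x, y] \<longleftrightarrow> False"
| "zigzag (x # y # z # zs) \<longleftrightarrow> x < y \<and> z < y \<and> zigzag (z # zs)"

text \<open>
  Occurrences in a list without repetitions are recorded by values instead of positions, which
  makes them independent of how the list is embedded in a longer one.
\<close>

definition occ132 :: "nat list \<Rightarrow> (nat \<times> nat \<times> nat) set" where
  "occ132 xs = {(a, c, b). a < b \<and> b < c \<and> precedes xs a c \<and> precedes xs c b}"

definition incs :: "nat \<Rightarrow> nat list \<Rightarrow> nat set set" where
  "incs k xs = {T. T \<subseteq> set xs \<and> card T = k \<and> (\<forall>x\<in>T. \<forall>y\<in>T. x < y \<longrightarrow> precedes xs x y)}"

lemma finite_occ132 [simp]: "finite (occ132 xs)"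
proof (rule finite_subset)
  show "occ132 xs \<subseteq> set xs \<times> set xs \<times> set xs"
    by (auto simp: occ132_def dest: precedes_in_set)
qed simp

lemma finite_incs [simp]: "finite (incs k xs)"
  by (rule finite_subset[of _ "Pow (set xs)"]) (auto simp: incs_def)

text \<open>Reading off values turns index triples into value triples. Distinctness makes this
  injective and lets an entry stand for its position.\<close>

lemma card_occurrences_132:
  assumes "distinct xs"
  shows "card (occurrences [1, 3, 2] xs) = card (occ132 xs)"
proof (rule bij_betw_same_card)
  let ?g = "\<lambda>is. (xs ! (is ! 0), xs ! (is ! 1), xs ! (is ! 2))"
  have all3: "(\<forall>a<length [1, 3, 2::nat]. P a) \<longleftrightarrow> P 0 \<and> P 1 \<and> P 2" for P
    by (auto simp: less_Suc_eq numeral_2_eq_2)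
  have occ: "is \<in> occurrences [1, 3, 2] xs \<longleftrightarrow> (\<exists>i j l. is = [i, j, l] \<and> i < j \<and> j < l \<and>
      l < length xs \<and> xs ! i < xs ! l \<and> xs ! l < xs ! j)" for "is"
    unfolding occurrences_def all3
    by (auto simp: length_Suc_conv)
  show "bij_betw ?g (occurrences [1, 3, 2] xs) (occ132 xs)"
  proof (rule bij_betwI')
    fix p q
    assume "p \<in> occurrences [1, 3, 2] xs" "q \<in> occurrences [1, 3, 2] xs"
    then show "(?g p = ?g q) = (p = q)"
      unfolding occ using assms by (auto simp: nth_eq_iff_index_eq)
  next
    fix p
    assume "p \<in> occurrences [1, 3, 2] xs"
    then show "?g p \<in> occ132 xs"
      unfolding occ occ132_def precedes_iff_nth by auto (blast intro: less_trans)+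
  next
    fix t
    assume "t \<in> occ132 xs"
    then obtain a c b i j j' l where t: "t = (a, c, b)" "a < b" "b < c"
      and ij: "i < j" "j < length xs" "xs ! i = a" "xs ! j = c"
      and jl: "j' < l" "l < length xs" "xs ! j' = c" "xs ! l = b"
      unfolding occ132_def precedes_iff_nth by auto
    have "j = j'" using assms ij jl by (metis nth_eq_iff_index_eq less_trans)
    then have "[i, j, l] \<in> occurrences [1, 3, 2] xs" using t ij jl unfolding occ by auto
    moreover have "t = ?g [i, j, l]" using t ij jl by simp
    ultimately show "\<exists>p\<in>occurrences [1, 3, 2] xs. t = ?g p" by blast
  qed
qed

text \<open>A strictly increasing index list is determined by its set, and distinctness lets that
  set be replaced by the set of values at those positions.\<close>

lemma card_occurrences_increasing:
  assumes "distinct xs"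
  shows "card (occurrences [1..<k + 1] xs) = card (incs k xs)"
proof (rule bij_betw_same_card)
  let ?g = "\<lambda>is. (!) xs ` set is"
  have occ: "is \<in> occurrences [1..<k + 1] xs \<longleftrightarrow> length is = k \<and> sorted_wrt (<) is \<and>
      set is \<subseteq> {..<length xs} \<and> (\<forall>a<k. \<forall>b<k. xs ! (is ! a) < xs ! (is ! b) \<longleftrightarrow> a < b)" for "is"
    unfolding occurrences_def by (auto simp: nth_append simp del: upt_Suc)
  have inj: "inj_on ((!) xs) {..<length xs}"
    using assms by (auto simp: inj_on_def nth_eq_iff_index_eq)
  show "bij_betw ?g (occurrences [1..<k + 1] xs) (incs k xs)"
  proof (rule bij_betwI')
    fix p q
    assume p: "p \<in> occurrences [1..<k + 1] xs" and q: "q \<in> occurrences [1..<k + 1] xs"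
    show "(?g p = ?g q) = (p = q)"
    proof
      assume "?g p = ?g q"
      then have "set p = set q"
        using inj p q unfolding occ by (metis inj_on_image_eq_iff)
      then show "p = q"
        using p q unfolding occ by (metis strict_sorted_equal)
    qed simp
  next
    fix p
    assume "p \<in> occurrences [1..<k + 1] xs"
    then have p: "length p = k" "sorted_wrt (<) p" "set p \<subseteq> {..<length xs}"
      "\<And>a b. a < k \<Longrightarrow> b < k \<Longrightarrow> xs ! (p ! a) < xs ! (p ! b) \<longleftrightarrow> a < b"
      unfolding occ by auto
    have "card (set p) = k"
      using p strict_sorted_iff distinct_card by metis
    then have "card (?g p) = k"
      using inj p(3) by (metis card_image inj_on_subset)
    moreover have "precedes xs x y" if xy: "x \<in> ?g p" "y \<in> ?g p" "x < y" for x y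
    proof -
      obtain a b where ab: "a < k" "b < k" "x = xs ! (p ! a)" "y = xs ! (p ! b)"
        using xy p(1) by (auto simp: in_set_conv_nth)
      then have "a < b" using xy p(4) by auto
      then have "p ! a < p ! b" using p ab by (simp add: sorted_wrt_nth_less)
      moreover have "p ! b < length xs" using ab p(1,3) nth_mem by blast
      ultimately show ?thesis using ab unfolding precedes_iff_nth by blast
    qed
    ultimately show "?g p \<in> incs k xs"
      using p(3) unfolding incs_def by auto
  next
    fix T
    assume "T \<in> incs k xs"
    then have T: "T \<subseteq> set xs" "card T = k" "\<And>x y. x \<in> T \<Longrightarrow> y \<in> T \<Longrightarrow> x < y \<Longrightarrow> precedes xs x y"
      unfolding incs_def by auto
    \<comment> \<open>The only candidate for a preimage: the positions holding the values of
      \<open>T\<close>, listed in increasing order.\<close>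
    define I where "I = {i. i < length xs \<and> xs ! i \<in> T}"
    define p where "p = sorted_list_of_set I"
    have I: "finite I" "I \<subseteq> {..<length xs}" unfolding I_def by auto
    have img: "(!) xs ` I = T" using T(1) unfolding I_def by (auto simp: in_set_conv_nth image_iff) (metis in_set_conv_nth subsetD)
    have cI: "card I = k" using inj I(2) img T(2) by (metis card_image inj_on_subset)
    have p: "length p = k" "sorted_wrt (<) p" "set p = I"
      using I cI unfolding p_def by auto
    \<comment> \<open>A descent along \<open>p\<close> would make \<open>T\<close> place the
      smaller, later value first, against \<open>precedes_antisym\<close>.\<close>
    have less: "xs ! (p ! a) < xs ! (p ! b)" if ab: "a < b" "b < k" for a b
    proof (rule ccontr)
      assume neg: "\<not> ?thesis"
      have pab: "p ! a < p ! b" using p ab by (simp add: sorted_wrt_nth_less)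
      have mem: "p ! a \<in> I" "p ! b \<in> I" using p ab by (auto simp flip: p(3))
      then have lt: "p ! a < length xs" "p ! b < length xs" using I by auto
      have "xs ! (p ! a) \<noteq> xs ! (p ! b)" using assms pab lt by (simp add: nth_eq_iff_index_eq)
      then have "precedes xs (xs ! (p ! b)) (xs ! (p ! a))"
        using neg mem img by (intro T(3)) auto
      moreover have "precedes xs (xs ! (p ! a)) (xs ! (p ! b))"
        using pab lt unfolding precedes_iff_nth by blast
      ultimately show False using precedes_antisym[OF assms] by blast
    qed
    have "xs ! (p ! a) < xs ! (p ! b) \<longleftrightarrow> a < b" if "a < k" "b < k" for a b
      using less[of a b] less[of b a] that by (cases a b rule: linorder_cases) auto
    then have "p \<in> occurrences [1..<k + 1] xs" using p I unfolding occ by auto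
    then show "\<exists>p\<in>occurrences [1..<k + 1] xs. T = ?g p" using p(3) img by metis
  qed
qed

section \<open>Alternating words\<close>

lemma zigzag_length: "zigzag xs \<Longrightarrow> odd (length xs)"
  by (induction xs rule: zigzag.induct) auto

text \<open>\<open>zigzag\<close> peels off two entries at a time, which preserves the parity of
  positions; the quantifier over positions has to be unrolled by the same step of two.\<close>

lemma all_nat_Suc_Suc: "(\<forall>i. P i) \<longleftrightarrow> P 0 \<and> P (Suc 0) \<and> (\<forall>i. P (Suc (Suc i)))"
  by (metis not0_implies_Suc)
lemma zigzag_iff:
  "zigzag xs \<longleftrightarrow> odd (length xs) \<and> (\<forall>i. i + 1 < length xs \<longrightarrow>
     (if even i then xs ! i < xs ! (i + 1) else xs ! i > xs ! (i + 1)))"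
proof (induction xs rule: zigzag.induct)
  case (4 x y z zs)
  let ?Q = "\<lambda>xs i. i + 1 < length xs \<longrightarrow>
     (if even i then xs ! i < xs ! (i + 1) else xs ! i > xs ! (i + 1))"
  have "(\<forall>i. ?Q (x # y # z # zs) i) \<longleftrightarrow> x < y \<and> z < y \<and> (\<forall>i. ?Q (z # zs) i)"
    by (subst all_nat_Suc_Suc) simp
  then show ?case unfolding zigzag.simps 4 by auto
qed auto

lemma up_down_iff: "up_down xs \<longleftrightarrow> zigzag xs \<and> length xs \<ge> 3"
  unfolding up_down_def zigzag_iff by auto

subsection \<open>Invariance under relabelling\<close>

text \<open>The two parts of a split carry value sets that need not be initial segments; this
  property is what allows them to be counted by size alone.\<close>

definition order_invariant :: "(nat list \<Rightarrow> bool) \<Rightarrow> bool" where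
  "order_invariant P \<longleftrightarrow> (\<forall>f xs. strict_mono_on (set xs) f \<longrightarrow> P (map f xs) = P xs)"

lemma strict_mono_on_less_iff:
  fixes f :: "nat \<Rightarrow> nat"
  shows "strict_mono_on A f \<Longrightarrow> x \<in> A \<Longrightarrow> y \<in> A \<Longrightarrow> f x < f y \<longleftrightarrow> x < y"
  by (cases x y rule: linorder_cases) (auto dest: strict_mono_onD)

lemma zigzag_map: "strict_mono_on (set xs) f \<Longrightarrow> zigzag (map f xs) = zigzag xs"
proof (induction xs rule: zigzag.induct)
  case (4 x y z zs)
  have "strict_mono_on (set (z # zs)) f"
    using "4.prems" by (rule monotone_on_subset) auto
  moreover have "f x < f y \<longleftrightarrow> x < y" "f z < f y \<longleftrightarrow> z < y"
    by (intro strict_mono_on_less_iff[OF "4.prems"]; simp)+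
  ultimately show ?case using "4.IH" by simp
qed auto

text \<open>Applying \<open>f\<close> entrywise is a bijection between the occurrences.
  \<open>precedes_map\<close> yields preimages only for pairs, so the middle entry receives two of
  them, which injectivity identifies.\<close>

lemma card_occ132_map:
  assumes f: "strict_mono_on (set xs) f"
  shows "card (occ132 (map f xs)) = card (occ132 xs)"
proof -
  let ?g = "\<lambda>(a, c, b). (f a, f c, f b)"
  have inj: "inj_on f (set xs)" using f by (rule strict_mono_on_imp_inj_on)
  have "occ132 (map f xs) = ?g ` occ132 xs"
  proof (intro equalityI subsetI)
    fix t assume "t \<in> occ132 (map f xs)"
    then obtain u w v where uwv: "t = (u, w, v)" "u < v" "v < w"
      "precedes (map f xs) u w" "precedes (map f xs) w v"
      unfolding occ132_def by blast
    obtain a c where ac: "precedes xs a c" "u = f a" "w = f c"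
      using uwv(4) unfolding precedes_map by blast
    obtain c' b where cb: "precedes xs c' b" "w = f c'" "v = f b"
      using uwv(5) unfolding precedes_map by blast
    have mem: "a \<in> set xs" "b \<in> set xs" "c \<in> set xs" "c' \<in> set xs"
      using ac(1) cb(1) by (auto dest: precedes_in_set)
    then have "c' = c" using inj ac(3) cb(2) by (simp add: inj_on_eq_iff)
    then have "(a, c, b) \<in> occ132 xs"
      using uwv ac cb mem unfolding occ132_def by (simp add: strict_mono_on_less_iff[OF f])
    then show "t \<in> ?g ` occ132 xs"
      using uwv(1) ac cb by (intro image_eqI[of _ _ "(a, c, b)"]) auto
  next
    fix t assume "t \<in> ?g ` occ132 xs"
    then obtain a c b where t: "t = (f a, f c, f b)" "a < b" "b < c" "precedes xs a c" "precedes xs c b"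
      unfolding occ132_def by auto
    moreover have "a \<in> set xs" "b \<in> set xs" "c \<in> set xs"
      using t(4,5) by (auto dest: precedes_in_set)
    ultimately have "f a < f b" "f b < f c" by (simp_all add: strict_mono_on_less_iff[OF f])
    moreover have "precedes (map f xs) (f a) (f c)" "precedes (map f xs) (f c) (f b)"
      using t(4,5) precedes_map by metis+
    ultimately show "t \<in> occ132 (map f xs)"
      unfolding occ132_def t(1) by simp
  qed
  moreover have "inj_on ?g (occ132 xs)"
  proof (rule inj_on_subset)
    show "occ132 xs \<subseteq> set xs \<times> set xs \<times> set xs"
      by (auto simp: occ132_def dest: precedes_in_set)
    show "inj_on ?g (set xs \<times> set xs \<times> set xs)"
      using inj by (intro inj_onI) (auto simp: inj_on_eq_iff)
  qed
  ultimately show ?thesis by (simp add: card_image)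
qed

lemma card_incs_map:
  assumes f: "strict_mono_on (set xs) f"
  shows "card (incs k (map f xs)) = card (incs k xs)"
proof -
  have inj: "inj_on f (set xs)" using f by (rule strict_mono_on_imp_inj_on)
  have pm: "precedes (map f xs) (f x) (f y) = precedes xs x y" if "x \<in> set xs" "y \<in> set xs" for x y
    using inj that precedes_in_set[of xs] unfolding precedes_map inj_on_def by metis
  have iff: "f ` T \<in> incs k (map f xs) \<longleftrightarrow> T \<in> incs k xs" if T: "T \<subseteq> set xs" for T
  proof -
    have "card (f ` T) = card T" using inj T by (metis card_image inj_on_subset)
    moreover have "(\<forall>x\<in>f ` T. \<forall>y\<in>f ` T. x < y \<longrightarrow> precedes (map f xs) x y) \<longleftrightarrow>
      (\<forall>x\<in>T. \<forall>y\<in>T. x < y \<longrightarrow> precedes xs x y)"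
      unfolding ball_simps
      by (intro ball_cong refl) (simp add: pm strict_mono_on_less_iff[OF f] subsetD[OF T])
    ultimately show ?thesis using T unfolding incs_def by auto
  qed
  have "incs k (map f xs) = image f ` incs k xs"
  proof (intro equalityI subsetI)
    fix S assume S: "S \<in> incs k (map f xs)"
    then have "S \<subseteq> f ` set xs" unfolding incs_def by auto
    then obtain T where "T \<subseteq> set xs" "S = f ` T" by (auto simp: subset_image_iff)
    then show "S \<in> image f ` incs k xs" using iff S by auto
  next
    fix S assume "S \<in> image f ` incs k xs"
    then obtain T where "T \<in> incs k xs" "S = f ` T" by auto
    moreover then have "T \<subseteq> set xs" unfolding incs_def by auto
    ultimately show "S \<in> incs k (map f xs)" using iff by simp
  qed
  moreover have "inj_on (image f) (incs k xs)"
    by (rule inj_on_subset[OF inj_on_image_Pow[OF inj]]) (auto simp: incs_def)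
  ultimately show ?thesis by (simp add: card_image)
qed

text \<open>For (c, t) = (0,0), (0,1), (1,0), (1,1) the generating functions of
  \<open>cls c k t\<close> are A, B, C, D.\<close>

definition cls :: "nat \<Rightarrow> nat \<Rightarrow> nat \<Rightarrow> nat list \<Rightarrow> bool" where
  "cls c k t xs \<longleftrightarrow> zigzag xs \<and> card (occ132 xs) = c \<and> card (incs k xs) = t"

lemma order_invariant_cls: "order_invariant (cls c k t)"
  unfolding order_invariant_def cls_def
  by (simp add: zigzag_map card_occ132_map card_incs_map)

subsection \<open>Generating functions and splitting at the maximum\<close>

definition num_perms :: "(nat list \<Rightarrow> bool) \<Rightarrow> nat set \<Rightarrow> nat" where
  "num_perms P S = card {xs \<in> permutations_of_set S. P xs}"

text \<open>The increasing enumeration of \<open>S\<close> is strictly monotone on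
  \<open>{..<card S}\<close>, so mapping it over the permutations there reaches all permutations of
  \<open>S\<close> without changing \<open>P\<close>.\<close>

lemma num_perms_card:
  assumes "order_invariant P" "finite S"
  shows "num_perms P S = num_perms P {..<card S}"
proof -
  let ?l = "sorted_list_of_set S"
  let ?f = "\<lambda>i. ?l ! i"
  have len: "length ?l = card S" by simp
  have mono: "strict_mono_on {..<card S} ?f"
    by (intro strict_mono_onI sorted_wrt_nth_less[of "(<)"]) auto
  have inj: "inj_on ?f {..<card S}" using mono by (rule strict_mono_on_imp_inj_on)
  have img: "?f ` {..<card S} = S"
    using assms(2) by (metis len set_sorted_list_of_set nth_image lessThan_atLeast0 take_all order_refl)
  have P: "P (map ?f xs) = P xs" if "xs \<in> permutations_of_set {..<card S}" for xs
    using assms(1) mono permutations_of_setD(1)[OF that] unfolding order_invariant_def by simp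
  have perms: "permutations_of_set S = map ?f ` permutations_of_set {..<card S}"
    using permutations_of_set_image_inj[OF inj] img by simp
  have "{xs \<in> permutations_of_set S. P xs} = map ?f ` {xs \<in> permutations_of_set {..<card S}. P xs}"
    unfolding perms using P by auto
  moreover have "inj_on (map ?f) {xs \<in> permutations_of_set {..<card S}. P xs}"
  proof (rule inj_on_subset)
    show "inj_on (map ?f) (lists {..<card S})" using inj by (rule inj_on_map_lists)
    show "{xs \<in> permutations_of_set {..<card S}. P xs} \<subseteq> lists {..<card S}"
      unfolding permutations_of_set_def by auto
  qed
  ultimately show ?thesis unfolding num_perms_def by (simp add: card_image)
qed

text \<open>Values start at 0 here; the return to permutations of \<open>{1..n}\<close> is made in
  \<open>gf_cls_1_1_eq_ud\<close>.\<close>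

definition gf :: "(nat list \<Rightarrow> bool) \<Rightarrow> rat fps" where
  "gf P = Abs_fps (\<lambda>n. of_nat (num_perms P {..<n}))"

lemma gf_cong:
  assumes "\<And>xs. distinct xs \<Longrightarrow> P xs \<longleftrightarrow> Q xs"
  shows "gf P = gf Q"
proof -
  have "{xs \<in> permutations_of_set S. P xs} = {xs \<in> permutations_of_set S. Q xs}" for S
    using assms by (auto dest: permutations_of_setD)
  then show ?thesis unfolding gf_def num_perms_def by simp
qed

lemma gf_or:
  assumes "\<And>xs. distinct xs \<Longrightarrow> \<not> (P xs \<and> Q xs)"
  shows "gf (\<lambda>xs. P xs \<or> Q xs) = gf P + gf Q"
proof -
  have "num_perms (\<lambda>xs. P xs \<or> Q xs) {..<n} = num_perms P {..<n} + num_perms Q {..<n}" for n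
  proof -
    have "{xs \<in> permutations_of_set {..<n}. P xs \<or> Q xs} =
      {xs \<in> permutations_of_set {..<n}. P xs} \<union> {xs \<in> permutations_of_set {..<n}. Q xs}" by blast
    moreover have "{xs \<in> permutations_of_set {..<n}. P xs} \<inter> {xs \<in> permutations_of_set {..<n}. Q xs} = {}"
      using assms by (auto dest: permutations_of_setD)
    ultimately show ?thesis unfolding num_perms_def by (simp add: card_Un_disjoint)
  qed
  then show ?thesis unfolding gf_def by (simp add: fps_eq_iff)
qed

lemma gf_False:
  assumes "\<And>xs. distinct xs \<Longrightarrow> \<not> P xs"
  shows "gf P = 0"
proof -
  have "{xs \<in> permutations_of_set S. P xs} = {}" for S
    using assms by (auto dest: permutations_of_setD)
  then show ?thesis unfolding gf_def num_perms_def by (simp add: fps_eq_iff)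
qed

lemma gf_singleton: "gf (\<lambda>xs. length xs = 1) = fps_X"
proof -
  have "num_perms (\<lambda>xs. length xs = 1) {..<n} = (if n = 1 then 1 else 0)" for n
  proof -
    have "{xs \<in> permutations_of_set {..<n}. length xs = 1} = (if n = 1 then {[0]} else {})"
    proof (cases "n = 1")
      case True
      have "{..<n} = {0}" using True by auto
      moreover have "{xs \<in> permutations_of_set {0::nat}. length xs = 1} = {[0]}" by auto
      ultimately show ?thesis using True by simp
    next
      case False
      then show ?thesis using length_finite_permutations_of_set[of _ "{..<n}"] by auto
    qed
    then show ?thesis unfolding num_perms_def by simp
  qed
  then show ?thesis unfolding gf_def by (simp add: fps_eq_iff)
qed

section \<open>Splitting a permutation at its maximum\<close>

definition split_max :: "nat list \<Rightarrow> nat list \<Rightarrow> nat \<Rightarrow> nat list \<Rightarrow> bool" where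
  "split_max xs \<alpha> m \<beta> \<longleftrightarrow> xs = \<alpha> @ m # \<beta> \<and> (\<forall>x\<in>set \<alpha> \<union> set \<beta>. x < m)"

lemma split_max_exists:
  assumes "distinct xs" "xs \<noteq> []"
  shows "\<exists>\<alpha> m \<beta>. split_max xs \<alpha> m \<beta>"
proof -
  have "Max (set xs) \<in> set xs" using assms by simp
  then obtain \<alpha> \<beta> where ab: "xs = \<alpha> @ Max (set xs) # \<beta>" by (meson split_list)
  have "x < Max (set xs)" if x: "x \<in> set \<alpha> \<union> set \<beta>" for x
  proof -
    have "x \<in> set xs" using x by (subst ab) auto
    then have "x \<le> Max (set xs)" by simp
    moreover have "Max (set xs) \<notin> set \<alpha> \<union> set \<beta>"
      using assms(1) by (subst (asm) ab) auto
    ultimately show ?thesis using x by (metis order_less_le)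
  qed
  then show ?thesis using ab unfolding split_max_def by blast
qed

lemma split_max_Max: "split_max xs \<alpha> m \<beta> \<Longrightarrow> m = Max (set xs)"
  unfolding split_max_def by (intro Max_eqI[symmetric]) (auto intro: less_imp_le)

text \<open>The strict bound keeps the maximum out of both parts, so its single position determines
  them.\<close>

lemma split_max_unique:
  assumes "split_max xs \<alpha> m \<beta>" "split_max xs \<alpha>' m' \<beta>'"
  shows "\<alpha>' = \<alpha> \<and> m' = m \<and> \<beta>' = \<beta>"
proof -
  have "m' = m" using assms[THEN split_max_Max] by simp
  moreover have "m \<notin> set \<alpha>" "m \<notin> set \<beta>"
    using assms(1) unfolding split_max_def by auto
  ultimately show ?thesis
    using assms append_Cons_eq_iff[of m \<alpha> \<beta> \<alpha>' \<beta>'] unfolding split_max_def by auto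
qed

definition joined :: "(nat list \<Rightarrow> nat list \<Rightarrow> bool) \<Rightarrow> nat list \<Rightarrow> bool" where
  "joined R xs \<longleftrightarrow> (\<exists>\<alpha> m \<beta>. split_max xs \<alpha> m \<beta> \<and> R \<alpha> \<beta>)"

lemma joined_iff: "split_max xs \<alpha> m \<beta> \<Longrightarrow> joined R xs \<longleftrightarrow> R \<alpha> \<beta>"
  unfolding joined_def by (blast dest: split_max_unique)

text \<open>Since the cut is unique, incompatible relations between the parts describe disjoint
  classes.\<close>

lemma gf_joined_or:
  assumes "\<And>\<alpha> \<beta>. \<not> (R \<alpha> \<beta> \<and> R' \<alpha> \<beta>)"
  shows "gf (joined (\<lambda>\<alpha> \<beta>. R \<alpha> \<beta> \<or> R' \<alpha> \<beta>)) = gf (joined R) + gf (joined R')"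
proof -
  have "gf (joined (\<lambda>\<alpha> \<beta>. R \<alpha> \<beta> \<or> R' \<alpha> \<beta>)) = gf (\<lambda>xs. joined R xs \<or> joined R' xs)"
    by (rule gf_cong) (auto simp: joined_def)
  also have "\<dots> = gf (joined R) + gf (joined R')"
    by (rule gf_or) (use assms in \<open>auto simp: joined_def dest: split_max_unique\<close>)
  finally show ?thesis .
qed

text \<open>\<open>S\<close> governs only the value sets of the two parts: for each admissible size
  \<open>j\<close> of the right part it allows exactly one pair of sets. Relabelling then turns the
  count for fixed \<open>j\<close> into a product.\<close>

lemma num_perms_joined:
  assumes inv: "order_invariant P" "order_invariant Q"
    and J: "finite J"
    and part: "\<And>j. j \<in> J \<Longrightarrow> A j \<union> B j = {..<n}" "\<And>j. j \<in> J \<Longrightarrow> A j \<inter> B j = {}"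
      "\<And>j. j \<in> J \<Longrightarrow> card (B j) = j"
    and S: "\<And>\<alpha> \<beta>. set \<alpha> \<union> set \<beta> = {..<n} \<Longrightarrow> set \<alpha> \<inter> set \<beta> = {} \<Longrightarrow>
      S \<alpha> \<beta> \<longleftrightarrow> (\<exists>j\<in>J. set \<alpha> = A j \<and> set \<beta> = B j)"
  shows "num_perms (joined (\<lambda>\<alpha> \<beta>. S \<alpha> \<beta> \<and> P \<alpha> \<and> Q \<beta>)) {..<Suc n} =
    (\<Sum>j\<in>J. num_perms Q {..<j} * num_perms P {..<n - j})"
proof -
  let ?R = "\<lambda>\<alpha> \<beta>. S \<alpha> \<beta> \<and> P \<alpha> \<and> Q \<beta>"
  let ?g = "\<lambda>(\<alpha>, \<beta>). \<alpha> @ n # \<beta>"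
  let ?C = "\<lambda>j. {xs \<in> permutations_of_set (A j). P xs} \<times> {xs \<in> permutations_of_set (B j). Q xs}"
  have fin: "finite (A j)" "finite (B j)" if "j \<in> J" for j
    using part(1)[OF that] finite_lessThan[of n] finite_Un[of "A j" "B j"] by simp_all
  have nmem: "n \<notin> A j" "n \<notin> B j" if "j \<in> J" for j
    using part(1)[OF that] by auto
  have eq: "{xs \<in> permutations_of_set {..<Suc n}. joined ?R xs} = ?g ` (\<Union>j\<in>J. ?C j)"
  proof (intro equalityI subsetI)
    fix xs
    assume "xs \<in> {xs \<in> permutations_of_set {..<Suc n}. joined ?R xs}"
    then have xs: "set xs = {..<Suc n}" "distinct xs" and "joined ?R xs"
      by (auto dest: permutations_of_setD)
    then obtain \<alpha> m \<beta> where sp: "split_max xs \<alpha> m \<beta>" and R: "?R \<alpha> \<beta>"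
      unfolding joined_def by blast
    have st: "set xs = insert m (set \<alpha> \<union> set \<beta>)" and lt: "\<And>x. x \<in> set \<alpha> \<union> set \<beta> \<Longrightarrow> x < m"
      using sp unfolding split_max_def by auto
    have "m \<in> set xs" unfolding st by simp
    then have "m \<le> n" unfolding xs(1) by simp
    have "n \<in> set xs" unfolding xs(1) by simp
    then have "n \<le> m" unfolding st using lt by (auto intro: less_imp_le)
    with \<open>m \<le> n\<close> have m: "m = n" by simp
    have "m \<notin> set \<alpha> \<union> set \<beta>" using lt by blast
    then have "set \<alpha> \<union> set \<beta> = set xs - {m}" unfolding st by blast
    also have "\<dots> = {..<n}" unfolding xs(1) m by auto
    finally have un: "set \<alpha> \<union> set \<beta> = {..<n}" .
    have dis: "set \<alpha> \<inter> set \<beta> = {}" "distinct \<alpha>" "distinct \<beta>"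
      using sp xs(2) unfolding split_max_def by auto
    obtain j where "j \<in> J" "set \<alpha> = A j" "set \<beta> = B j" using S[OF un dis(1)] R by blast
    then have "(\<alpha>, \<beta>) \<in> (\<Union>j\<in>J. ?C j)" using dis R by (auto intro: permutations_of_setI)
    moreover have "xs = ?g (\<alpha>, \<beta>)" using sp m unfolding split_max_def by simp
    ultimately show "xs \<in> ?g ` (\<Union>j\<in>J. ?C j)" by blast
  next
    fix xs
    assume "xs \<in> ?g ` (\<Union>j\<in>J. ?C j)"
    then obtain j \<alpha> \<beta> where j: "j \<in> J" and xs: "xs = \<alpha> @ n # \<beta>"
      and mem: "\<alpha> \<in> permutations_of_set (A j)" "\<beta> \<in> permutations_of_set (B j)" "P \<alpha>" "Q \<beta>"
      by auto
    note ab = permutations_of_setD[OF mem(1)] permutations_of_setD[OF mem(2)] mem(3,4)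
    have un: "set \<alpha> \<union> set \<beta> = {..<n}" "set \<alpha> \<inter> set \<beta> = {}" using ab part[OF j] by simp_all
    then have "set xs = {..<Suc n}" "distinct xs" using xs ab by auto
    moreover have "split_max xs \<alpha> n \<beta>" using xs un unfolding split_max_def by simp
    moreover have "?R \<alpha> \<beta>" using S[OF un] j ab by blast
    ultimately show "xs \<in> {xs \<in> permutations_of_set {..<Suc n}. joined ?R xs}"
      unfolding joined_def by (blast intro: permutations_of_setI)
  qed
  \<comment> \<open>\<open>n\<close> occurs in neither part, so its position in the concatenation
    recovers both.\<close>
  have inj: "inj_on ?g (\<Union>j\<in>J. ?C j)"
  proof (rule inj_onI)
    fix p q
    assume pq: "p \<in> (\<Union>j\<in>J. ?C j)" "q \<in> (\<Union>j\<in>J. ?C j)" "?g p = ?g q"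
    obtain j where "j \<in> J" "p \<in> ?C j" using pq(1) by blast
    then have "n \<notin> set (fst p)" "n \<notin> set (snd p)"
      using nmem[of j] by (auto dest: permutations_of_setD)
    then have "fst p = fst q \<and> snd p = snd q"
      using pq(3) append_Cons_eq_iff[of n "fst p" "snd p" "fst q" "snd q"]
      by (simp add: case_prod_beta)
    then show "p = q" by (simp add: prod_eq_iff)
  qed
  have cC: "card (?C j) = num_perms Q {..<j} * num_perms P {..<n - j}" if j: "j \<in> J" for j
  proof -
    have "card (A j) + card (B j) = n"
      using card_Un_disjoint[OF fin[OF j] part(2)[OF j]] part(1)[OF j] by simp
    then have "card (A j) = n - j" using part(3)[OF j] by simp
    then have "num_perms P (A j) = num_perms P {..<n - j}" "num_perms Q (B j) = num_perms Q {..<j}"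
      using num_perms_card[OF inv(1) fin(1)[OF j]] num_perms_card[OF inv(2) fin(2)[OF j]]
        part(3)[OF j] by simp_all
    then show ?thesis unfolding num_perms_def card_cartesian_product by simp
  qed
  have "num_perms (joined ?R) {..<Suc n} = card (\<Union>j\<in>J. ?C j)"
    unfolding num_perms_def eq by (rule card_image[OF inj])
  also have "\<dots> = (\<Sum>j\<in>J. card (?C j))"
  proof (rule card_UN_disjoint[OF J])
    show "\<forall>j\<in>J. finite (?C j)" by simp
    show "\<forall>i\<in>J. \<forall>j\<in>J. i \<noteq> j \<longrightarrow> ?C i \<inter> ?C j = {}"
    proof (intro ballI impI)
      fix i j assume ij: "i \<in> J" "j \<in> J" "i \<noteq> j"
      then have "B i \<noteq> B j" using part(3)[of i] part(3)[of j] by auto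
      then show "?C i \<inter> ?C j = {}" by (auto dest: permutations_of_setD)
    qed
  qed
  also have "\<dots> = (\<Sum>j\<in>J. num_perms Q {..<j} * num_perms P {..<n - j})"
    by (rule sum.cong[OF refl cC])
  finally show ?thesis .
qed

text \<open>The count of \<open>num_perms_joined\<close> is a convolution, and \<open>fps_X\<close>
  accounts for the maximum. \<open>J n\<close> may omit 0 and n because \<open>P\<close> and
  \<open>Q\<close> reject the empty list, so those summands vanish.\<close>

lemma gf_joined:
  assumes inv: "order_invariant P" "order_invariant Q" and ne: "\<not> P []" "\<not> Q []"
    and S: "\<And>n \<alpha> \<beta>. set \<alpha> \<union> set \<beta> = {..<n} \<Longrightarrow> set \<alpha> \<inter> set \<beta> = {} \<Longrightarrow>
      S \<alpha> \<beta> \<longleftrightarrow> (\<exists>j\<in>J n. set \<alpha> = A n j \<and> set \<beta> = B n j)"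
    and J: "\<And>n. {1..<n} \<subseteq> J n" "\<And>n. J n \<subseteq> {0..n}"
    and part: "\<And>n j. j \<in> J n \<Longrightarrow> A n j \<union> B n j = {..<n}" "\<And>n j. j \<in> J n \<Longrightarrow> A n j \<inter> B n j = {}"
      "\<And>n j. j \<in> J n \<Longrightarrow> card (B n j) = j"
  shows "gf (joined (\<lambda>\<alpha> \<beta>. S \<alpha> \<beta> \<and> P \<alpha> \<and> Q \<beta>)) = fps_X * (gf P * gf Q)"
proof (rule fps_ext)
  fix n
  let ?R = "\<lambda>\<alpha> \<beta>. S \<alpha> \<beta> \<and> P \<alpha> \<and> Q \<beta>"
  have c0: "num_perms P {..<0} = 0" "num_perms Q {..<0} = 0"
    using ne unfolding num_perms_def by auto
  show "gf (joined ?R) $ n = (fps_X * (gf P * gf Q)) $ n"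
  proof (cases n)
    case 0
    then show ?thesis unfolding gf_def num_perms_def joined_def split_max_def by simp
  next
    case (Suc n')
    have fin: "finite (J n')" using J(2) finite_subset by blast
    have "num_perms (joined ?R) {..<Suc n'} = (\<Sum>j\<in>J n'. num_perms Q {..<j} * num_perms P {..<n' - j})"
      by (rule num_perms_joined[OF inv fin part S])
    also have "\<dots> = (\<Sum>j=0..n'. num_perms Q {..<j} * num_perms P {..<n' - j})"
    proof (rule sum.mono_neutral_left)
      show "\<forall>j\<in>{0..n'} - J n'. num_perms Q {..<j} * num_perms P {..<n' - j} = 0"
      proof
        fix j assume "j \<in> {0..n'} - J n'"
        then have "j = 0 \<or> j = n'" using J(1)[of n'] by (cases "j = 0"; cases "j = n'") (auto simp: subset_iff)
        then show "num_perms Q {..<j} * num_perms P {..<n' - j} = 0" using c0 by auto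
      qed
    qed (use J(2) in auto)
    also have "rat_of_nat \<dots> = (gf Q * gf P) $ n'"
      by (simp add: gf_def fps_mult_nth)
    also have "\<dots> = (fps_X * (gf P * gf Q)) $ Suc n'"
      by (simp add: mult.commute)
    finally show ?thesis unfolding Suc gf_def by simp
  qed
qed

section \<open>The two admissible distributions of values\<close>

definition below :: "nat list \<Rightarrow> nat list \<Rightarrow> bool" where
  "below \<alpha> \<beta> \<longleftrightarrow> (\<forall>x\<in>set \<alpha>. \<forall>y\<in>set \<beta>. y < x)"

definition crossed :: "nat list \<Rightarrow> nat list \<Rightarrow> bool" where
  "crossed \<alpha> \<beta> \<longleftrightarrow> (\<exists>a\<in>set \<alpha>. \<exists>b\<in>set \<beta>. a < b \<and> (\<forall>x\<in>set \<alpha>. \<forall>y\<in>set \<beta>. x < y \<longrightarrow> x = a \<and> y = b))"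

text \<open>If everything on the left is larger, the right part must hold the \<open>j\<close>
  smallest values, where \<open>j\<close> is its number of values.\<close>

lemma gf_joined_below:
  assumes "order_invariant P" "order_invariant Q" and "\<not> P []" "\<not> Q []"
  shows "gf (joined (\<lambda>\<alpha> \<beta>. below \<alpha> \<beta> \<and> P \<alpha> \<and> Q \<beta>)) = fps_X * (gf P * gf Q)"
proof (rule gf_joined[OF assms, where J = "\<lambda>n. {0..n}" and A = "\<lambda>n j. {j..<n}" and B = "\<lambda>n j. {..<j}"])
  fix n :: nat and \<alpha> \<beta> :: "nat list"
  assume un: "set \<alpha> \<union> set \<beta> = {..<n}" and dis: "set \<alpha> \<inter> set \<beta> = {}"
  show "below \<alpha> \<beta> \<longleftrightarrow> (\<exists>j\<in>{0..n}. set \<alpha> = {j..<n} \<and> set \<beta> = {..<j})"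
  proof
    assume bel: "below \<alpha> \<beta>"
    \<comment> \<open>The smallest value missing on the right. Unless it is \<open>n\<close> it lies
      on the left, and a larger value on the right would then contradict
      \<open>below\<close>.\<close>
    define j where "j = (LEAST j. j \<notin> set \<beta>)"
    have "n \<notin> set \<beta>" using un by auto
    then have j: "j \<notin> set \<beta>" "j \<le> n"
      unfolding j_def by (rule LeastI, rule Least_le)
    have lt: "z \<in> set \<beta>" if "z < j" for z using that not_less_Least unfolding j_def by blast
    have gt: "z < j" if z: "z \<in> set \<beta>" for z
    proof (rule ccontr)
      assume "\<not> z < j"
      then have jz: "j < z" using z j(1) by (metis linorder_neqE_nat)
      moreover have "z < n" using un z by auto
      ultimately have "j \<in> set \<alpha>" using un j by (metis UnE lessThan_iff less_trans)
      then show False using bel z jz unfolding below_def by fastforce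
    qed
    have "set \<beta> = {..<j}" using lt gt by auto
    moreover have "set \<alpha> = {..<n} - set \<beta>" using un dis by blast
    ultimately have "set \<alpha> = {j..<n}" by auto
    then show "\<exists>j\<in>{0..n}. set \<alpha> = {j..<n} \<and> set \<beta> = {..<j}"
      using \<open>set \<beta> = {..<j}\<close> j by auto
  next
    assume "\<exists>j\<in>{0..n}. set \<alpha> = {j..<n} \<and> set \<beta> = {..<j}"
    then show "below \<alpha> \<beta>" unfolding below_def by auto
  qed
qed auto

text \<open>The value sets are those of the \<open>below\<close> case with the adjacent values
  \<open>j - 1\<close> and \<open>j\<close> exchanged. Both parts are nonempty, hence 1 <= j <
  n.\<close>

lemma gf_joined_crossed:
  assumes "order_invariant P" "order_invariant Q" and "\<not> P []" "\<not> Q []"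
  shows "gf (joined (\<lambda>\<alpha> \<beta>. crossed \<alpha> \<beta> \<and> P \<alpha> \<and> Q \<beta>)) = fps_X * (gf P * gf Q)"
proof (rule gf_joined[OF assms, where J = "\<lambda>n. {1..<n}" and A = "\<lambda>n j. insert (j - 1) {Suc j..<n}"
      and B = "\<lambda>n j. insert j {..<j - 1}"])
  fix n :: nat and \<alpha> \<beta> :: "nat list"
  assume un: "set \<alpha> \<union> set \<beta> = {..<n}" and dis: "set \<alpha> \<inter> set \<beta> = {}"
  show "crossed \<alpha> \<beta> \<longleftrightarrow>
    (\<exists>j\<in>{1..<n}. set \<alpha> = insert (j - 1) {Suc j..<n} \<and> set \<beta> = insert j {..<j - 1})"
  proof
    assume "crossed \<alpha> \<beta>"
    then obtain a b where ab: "a \<in> set \<alpha>" "b \<in> set \<beta>" "a < b"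
      and only: "\<And>x y. x \<in> set \<alpha> \<Longrightarrow> y \<in> set \<beta> \<Longrightarrow> x < y \<Longrightarrow> x = a \<and> y = b"
      unfolding crossed_def by blast
    have bn: "b < n" using ab un by auto
    have lo: "z \<in> set \<beta>" if "z < b" "z \<noteq> a" for z
    proof -
      have "z \<notin> set \<alpha>" using only ab that by blast
      moreover have "z \<in> {..<n}" using that bn by simp
      ultimately show ?thesis using un by blast
    qed
    have hi: "z \<notin> set \<beta>" if "z > a" "z \<noteq> b" for z
      using only ab that by blast
    \<comment> \<open>A value strictly between \<open>a\<close> and \<open>b\<close> would be forced
      into the right part by \<open>lo\<close> and out of it by \<open>hi\<close>.\<close>
    have b: "b = Suc a"
    proof (rule ccontr)
      assume "b \<noteq> Suc a"
      then have "Suc a < b" using ab by simp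
      then show False using lo[of "Suc a"] hi[of "Suc a"] by simp
    qed
    have a: "a \<notin> set \<beta>" using ab dis by blast
    have \<beta>: "set \<beta> = insert b {..<b - 1}"
    proof (intro equalityI subsetI)
      fix z assume z: "z \<in> set \<beta>"
      show "z \<in> insert b {..<b - 1}"
      proof (cases "z = b")
        case False
        then have "\<not> z > a" using hi z by blast
        moreover have "z \<noteq> a" using a z by blast
        ultimately show ?thesis using b by simp
      qed simp
    next
      fix z assume "z \<in> insert b {..<b - 1}"
      then show "z \<in> set \<beta>" using lo ab b by auto
    qed
    have "set \<alpha> = {..<n} - set \<beta>" using un dis by blast
    also have "\<dots> = insert a {Suc (Suc a)..<n}"
      unfolding \<beta> b using bn b by (intro set_eqI) (simp, linarith)
    finally have \<alpha>: "set \<alpha> = insert (b - 1) {Suc b..<n}" using b by simp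
    have "b \<in> {1..<n}" using b bn by simp
    then show "\<exists>j\<in>{1..<n}. set \<alpha> = insert (j - 1) {Suc j..<n} \<and> set \<beta> = insert j {..<j - 1}"
      using \<alpha> \<beta> by blast
  next
    assume "\<exists>j\<in>{1..<n}. set \<alpha> = insert (j - 1) {Suc j..<n} \<and> set \<beta> = insert j {..<j - 1}"
    then obtain j where j: "j \<in> {1..<n}" "set \<alpha> = insert (j - 1) {Suc j..<n}" "set \<beta> = insert j {..<j - 1}"
      by blast
    have "x = j - 1 \<and> y = j" if "x \<in> set \<alpha>" "y \<in> set \<beta>" "x < y" for x y
      using that unfolding j(2,3) by auto
    moreover have "j - 1 \<in> set \<alpha>" "j \<in> set \<beta>" "j - 1 < j" using j by auto
    ultimately show "crossed \<alpha> \<beta>" unfolding crossed_def by blast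
  qed
next
  fix n j :: nat
  assume j: "j \<in> {1..<n}"
  then obtain i where i: "j = Suc i" by (cases j) auto
  show "insert (j - 1) {Suc j..<n} \<union> insert j {..<j - 1} = {..<n}"
    using j unfolding i by (intro set_eqI) (simp, linarith)
  show "insert (j - 1) {Suc j..<n} \<inter> insert j {..<j - 1} = {}"
    unfolding i by auto
  show "card (insert j {..<j - 1}) = j" unfolding i by simp
qed auto

subsection \<open>Statistics of a split permutation\<close>

text \<open>Beyond length 1 the maximum must be a peak, and as a peak it satisfies both of its
  inequalities automatically; what remains is the alternation of the two sides.\<close>

lemma zigzag_split_max:
  assumes "split_max xs \<alpha> m \<beta>"
  shows "zigzag xs \<longleftrightarrow> length xs = 1 \<or> zigzag \<alpha> \<and> zigzag \<beta>"
proof -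
  have "zigzag (\<alpha> @ m # \<beta>) \<longleftrightarrow> \<alpha> = [] \<and> \<beta> = [] \<or> zigzag \<alpha> \<and> zigzag \<beta>"
    if "\<forall>x\<in>set \<alpha> \<union> set \<beta>. x < m"
    using that
  proof (induction \<alpha> rule: zigzag.induct)
    case 1
    then show ?case by (cases "m # \<beta>" rule: zigzag.cases) auto
  next
    case (2 x)
    then show ?case by (cases \<beta>) auto
  next
    case (4 x y z zs)
    then show ?case by auto
  qed auto
  then show ?thesis using assms unfolding split_max_def by auto
qed

text \<open>This prevents the unique ascent across the maximum from creating a second 132.\<close>

lemma last_le_if_zigzag:
  assumes "zigzag xs" "occ132 xs = {}" "x \<in> set xs"
  shows "last xs \<le> x"
  using assms
proof (induction xs arbitrary: x rule: zigzag.induct)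
  case (4 u y z zs)
  let ?l = "last (z # zs)"
  have "occ132 (z # zs) \<subseteq> occ132 (u # y # z # zs)" unfolding occ132_def by auto
  then have IH: "?l \<le> w" if "w \<in> set (z # zs)" for w
    using 4 that by (metis subset_empty zigzag.simps(4))
  have "z < y" using "4.prems"(1) by simp
  \<comment> \<open>If \<open>u\<close> were smaller than the last entry, then \<open>u\<close>, the
    peak \<open>y\<close> and the last entry would form a 132.\<close>
  have "?l \<le> u"
  proof (rule ccontr)
    assume "\<not> ?l \<le> u"
    moreover have "?l < y" using IH[of z] \<open>z < y\<close> by simp
    moreover have "?l \<in> set (z # zs)" by (rule last_in_set) simp
    ultimately have "(u, y, ?l) \<in> occ132 (u # y # z # zs)"
      unfolding occ132_def by (auto simp del: last.simps)
    then show False using "4.prems"(2) by simp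
  qed
  moreover have "?l \<le> y" using IH[of z] \<open>z < y\<close> by simp
  ultimately show ?case using "4.prems"(3) IH by (auto simp del: last.simps simp: last_ConsR)
qed auto

lemma not_precedes_last: "distinct xs \<Longrightarrow> \<not> precedes xs (last xs) y"
proof (induction xs)
  case (Cons z zs)
  then show ?case by (cases "zs = []") auto
qed simp

section \<open>Occurrences of both patterns in a split permutation\<close>

context
  fixes xs \<alpha> \<beta> :: "nat list" and m :: nat
  assumes distinct: "distinct xs" and split: "split_max xs \<alpha> m \<beta>"
begin

lemma split_facts:
  shows "xs = \<alpha> @ m # \<beta>" "distinct \<alpha>" "distinct \<beta>" "set \<alpha> \<inter> set \<beta> = {}"
    "m \<notin> set \<alpha>" "m \<notin> set \<beta>" "\<And>x. x \<in> set \<alpha> \<Longrightarrow> x < m" "\<And>x. x \<in> set \<beta> \<Longrightarrow> x < m"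
  using distinct split unfolding split_max_def by auto

lemma precedes_split:
  "precedes xs x y \<longleftrightarrow> precedes \<alpha> x y \<or> precedes \<beta> x y \<or> x \<in> set \<alpha> \<and> y = m
    \<or> x = m \<and> y \<in> set \<beta> \<or> x \<in> set \<alpha> \<and> y \<in> set \<beta>"
  unfolding split_facts(1) precedes_append by auto

text \<open>The maximum can only play the 3. An occurrence that meets both parts has its 1 on the
  left and its 2 on the right, so only the place of the 3 is open.\<close>

lemma occ132_split:
  "(a, c, b) \<in> occ132 xs \<longleftrightarrow> (a, c, b) \<in> occ132 \<alpha> \<or> (a, c, b) \<in> occ132 \<beta> \<or>
    a < b \<and> b < c \<and> a \<in> set \<alpha> \<and> b \<in> set \<beta> \<and> (c = m \<or> precedes \<alpha> a c \<or> precedes \<beta> c b)"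
proof -
  have in\<alpha>: "x \<in> set \<alpha>" "y \<in> set \<alpha>" "x \<notin> set \<beta>" "y \<notin> set \<beta>" "x \<noteq> m" "y \<noteq> m" if "precedes \<alpha> x y" for x y
    using precedes_in_set[OF that] split_facts(4,5) by auto
  have in\<beta>: "x \<in> set \<beta>" "y \<in> set \<beta>" "x \<notin> set \<alpha>" "y \<notin> set \<alpha>" "x \<noteq> m" "y \<noteq> m" if "precedes \<beta> x y" for x y
    using precedes_in_set[OF that] split_facts(4,6) by auto
  show ?thesis
    unfolding occ132_def mem_Collect_eq case_prod_conv precedes_split
    using in\<alpha>[of a c] in\<alpha>[of c b] in\<beta>[of a c] in\<beta>[of c b] split_facts(4-8)
    by (smt (verit, best) disjoint_iff less_asym less_trans)
qed

lemma occ132_sub: "occ132 \<alpha> \<subseteq> occ132 xs" "occ132 \<beta> \<subseteq> occ132 xs"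
  by (auto simp: occ132_split)

lemma max_notin_occ132: "(a, m, b) \<notin> occ132 \<alpha>" "(a, m, b) \<notin> occ132 \<beta>"
  using split_facts(5,6) precedes_in_set[of _ a m] unfolding occ132_def by auto

lemma occ132_disjoint: "occ132 \<alpha> \<inter> occ132 \<beta> = {}"
proof -
  have "occ132 zs \<subseteq> set zs \<times> UNIV" for zs
    by (auto simp: occ132_def dest: precedes_in_set)
  then show ?thesis using split_facts(4) by blast
qed

text \<open>Each ascending pair across the maximum yields its own occurrence; hence at most one
  occurrence allows at most one such pair.\<close>

lemma occ132_crossing:
  "a \<in> set \<alpha> \<Longrightarrow> b \<in> set \<beta> \<Longrightarrow> a < b \<Longrightarrow> (a, m, b) \<in> occ132 xs"
  using split_facts(8) by (simp add: occ132_split)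

lemma card_occ132_below:
  assumes "below \<alpha> \<beta>"
  shows "card (occ132 xs) = card (occ132 \<alpha>) + card (occ132 \<beta>)"
proof -
  have "\<not> (a \<in> set \<alpha> \<and> b \<in> set \<beta> \<and> a < b)" for a b
    using assms unfolding below_def by (meson less_asym)
  then have "occ132 xs = occ132 \<alpha> \<union> occ132 \<beta>"
    by (auto simp: occ132_split)
  then show ?thesis using occ132_disjoint by (simp add: card_Un_disjoint)
qed

text \<open>A 3 other than the maximum would have to follow \<open>a\<close> inside \<alpha>, but
  \<open>a\<close> is the last entry there, or precede \<open>b\<close> inside \<beta> and exceed
  it, which would give a second ascending pair with \<open>a\<close>.\<close>

lemma card_occ132_crossed:
  assumes cr: "crossed \<alpha> \<beta>" and \<alpha>: "zigzag \<alpha>" "occ132 \<alpha> = {}" and \<beta>: "occ132 \<beta> = {}"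
  shows "card (occ132 xs) = 1"
proof -
  obtain a b where ab: "a \<in> set \<alpha>" "b \<in> set \<beta>" "a < b"
    and only: "\<And>x y. x \<in> set \<alpha> \<Longrightarrow> y \<in> set \<beta> \<Longrightarrow> x < y \<Longrightarrow> x = a \<and> y = b"
    using cr unfolding crossed_def by blast
  have "last \<alpha> \<le> a" using last_le_if_zigzag[OF \<alpha> ab(1)] .
  moreover have "last \<alpha> \<in> set \<alpha>" using ab(1) by (intro last_in_set) auto
  \<comment> \<open>\<open>last \<alpha>\<close> lies below \<open>b\<close> as well, so by
    uniqueness of the ascending pair it is \<open>a\<close>.\<close>
  ultimately have "last \<alpha> = a" using only[of "last \<alpha>" b] ab by auto
  then have na: "\<not> precedes \<alpha> a c" for c
    using not_precedes_last[OF split_facts(2)] by simp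
  have nb: "\<not> (precedes \<beta> c b \<and> b < c)" for c
  proof
    assume c: "precedes \<beta> c b \<and> b < c"
    then have "c \<in> set \<beta>" "a < c" using precedes_in_set[of \<beta> c b] ab by auto
    then show False using only[of a c] ab c by simp
  qed
  have "t \<in> occ132 xs \<longleftrightarrow> t = (a, m, b)" for t
  proof (cases t)
    case (fields x z y)
    show ?thesis
      unfolding fields occ132_split \<alpha> \<beta>
      using only[of x y] ab na[of z] nb[of z] split_facts(8)[of b] by auto
  qed
  then have "occ132 xs = {(a, m, b)}" by blast
  then show ?thesis by simp
qed

lemma below_if_no_occ132: "occ132 xs = {} \<Longrightarrow> below \<alpha> \<beta>"
  unfolding below_def
proof (intro ballI)
  fix x y assume xy: "occ132 xs = {}" "x \<in> set \<alpha>" "y \<in> set \<beta>"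
  then have "\<not> x < y" using occ132_crossing[of x y] by auto
  moreover have "x \<noteq> y" using xy split_facts(4) by blast
  ultimately show "y < x" by simp
qed

text \<open>A pair across the maximum already accounts for the one occurrence, with \<open>m\<close>
  as its 3; a second pair or an occurrence inside a part would differ from it.\<close>

lemma crossed_if_one_occ132:
  assumes "card (occ132 xs) = 1" "\<not> below \<alpha> \<beta>"
  shows "crossed \<alpha> \<beta> \<and> occ132 \<alpha> = {} \<and> occ132 \<beta> = {}"
proof -
  obtain t where t: "occ132 xs = {t}" using assms(1) card_1_singletonE by blast
  obtain a b where ab: "a \<in> set \<alpha>" "b \<in> set \<beta>" "\<not> b < a" using assms(2) unfolding below_def by blast
  then have lt: "a < b" using split_facts(4) by (metis disjoint_iff linorder_neqE_nat)
  then have t': "t = (a, m, b)" using occ132_crossing[of a b] ab t by simp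
  have "x = a \<and> y = b" if "x \<in> set \<alpha>" "y \<in> set \<beta>" "x < y" for x y
    using occ132_crossing[OF that] unfolding t t' by simp
  then have "crossed \<alpha> \<beta>" using ab lt unfolding crossed_def by blast
  moreover have "occ132 \<alpha> = {}" "occ132 \<beta> = {}"
    using occ132_sub max_notin_occ132[of a b] unfolding t t' by auto
  ultimately show ?thesis by blast
qed

text \<open>An increasing set containing the maximum contains nothing from \<beta>, since the
  maximum comes before all of \<beta>. The assumption \<open>no\<close> isolates the only point
  where the relative position of the values of \<alpha> and \<beta> matters.\<close>

lemma incs_split:
  assumes "k \<ge> 2" and no: "\<And>T. T \<in> incs k xs \<Longrightarrow> m \<notin> T \<Longrightarrow> T \<inter> set \<alpha> = {} \<or> T \<inter> set \<beta> = {}"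
  shows "incs k xs = incs k \<alpha> \<union> insert m ` incs (k - 1) \<alpha> \<union> incs k \<beta>"
proof (intro equalityI subsetI)
  fix T assume T: "T \<in> incs k xs"
  then have sub: "T \<subseteq> insert m (set \<alpha> \<union> set \<beta>)" and card: "card T = k"
    and pr: "\<And>x y. x \<in> T \<Longrightarrow> y \<in> T \<Longrightarrow> x < y \<Longrightarrow> precedes xs x y"
    unfolding incs_def split_facts(1) by auto
  have pr\<alpha>: "precedes \<alpha> x y" if "x \<in> T" "y \<in> T" "x < y" "x \<in> set \<alpha>" "y \<in> set \<alpha>" for x y
  proof -
    have "\<not> precedes \<beta> x y" using precedes_in_set[of \<beta> x y] that split_facts(4) by blast
    then show ?thesis using pr[OF that(1-3)] that split_facts(4,5) unfolding precedes_split by blast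
  qed
  have pr\<beta>: "precedes \<beta> x y" if "x \<in> T" "y \<in> T" "x < y" "x \<in> set \<beta>" "y \<in> set \<beta>" for x y
  proof -
    have "\<not> precedes \<alpha> x y" using precedes_in_set[of \<alpha> x y] that split_facts(4) by blast
    then show ?thesis using pr[OF that(1-3)] that split_facts(4,6) unfolding precedes_split by blast
  qed
  show "T \<in> incs k \<alpha> \<union> insert m ` incs (k - 1) \<alpha> \<union> incs k \<beta>"
  proof (cases "m \<in> T")
    case True
    have "y \<notin> T" if y: "y \<in> set \<beta>" for y
    proof
      assume "y \<in> T"
      then have "precedes xs y m" using pr True split_facts(8)[OF y] by blast
      then show False
        using y split_facts(4-6) precedes_in_set[of \<alpha> y m] precedes_in_set[of \<beta> y m]
        unfolding precedes_split by blast
    qed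
    then have sub': "T - {m} \<subseteq> set \<alpha>" using sub by blast
    then have "finite (T - {m})" using finite_subset by blast
    then have "card (T - {m}) = k - 1" using card True by simp
    then have "T - {m} \<in> incs (k - 1) \<alpha>"
      using sub' pr\<alpha> unfolding incs_def by blast
    moreover have "T = insert m (T - {m})" using True by blast
    ultimately show ?thesis by blast
  next
    case False
    then consider "T \<subseteq> set \<alpha>" | "T \<subseteq> set \<beta>" using no[OF T] sub by blast
    then show ?thesis
    proof cases
      case 1
      then have "T \<in> incs k \<alpha>" using card pr\<alpha> unfolding incs_def by blast
      then show ?thesis by blast
    next
      case 2
      then have "T \<in> incs k \<beta>" using card pr\<beta> unfolding incs_def by blast
      then show ?thesis by blast
    qed
  qed
next
  fix T assume "T \<in> incs k \<alpha> \<union> insert m ` incs (k - 1) \<alpha> \<union> incs k \<beta>"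
  then consider "T \<in> incs k \<alpha>" | T' where "T = insert m T'" "T' \<in> incs (k - 1) \<alpha>" | "T \<in> incs k \<beta>"
    by blast
  then show "T \<in> incs k xs"
  proof cases
    case 1
    moreover have "set \<alpha> \<subseteq> set xs" by (auto simp: split_facts(1))
    ultimately show ?thesis unfolding incs_def precedes_split by blast
  next
    case 3
    moreover have "set \<beta> \<subseteq> set xs" by (auto simp: split_facts(1))
    ultimately show ?thesis unfolding incs_def precedes_split by blast
  next
    case 2
    have T': "T' \<subseteq> set \<alpha>" "card T' = k - 1" "\<And>x y. x \<in> T' \<Longrightarrow> y \<in> T' \<Longrightarrow> x < y \<Longrightarrow> precedes \<alpha> x y"
      using 2(2) unfolding incs_def by auto
    have "finite T'" "m \<notin> T'" using T'(1) split_facts(5) finite_subset by blast+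
    then have "card T = k" using T'(2) 2(1) assms(1) by simp
    moreover have "T \<subseteq> set xs" using T'(1) 2(1) split_facts(1) by auto
    moreover have "precedes xs x y" if xy: "x \<in> T" "y \<in> T" "x < y" for x y
    proof -
      have "x \<noteq> m"
      proof
        assume "x = m"
        then have "y \<in> set \<alpha>" using xy 2(1) T'(1) by auto
        then show False using split_facts(7) xy(3) \<open>x = m\<close> by (meson less_asym)
      qed
      then have x: "x \<in> T'" using xy 2(1) by simp
      show ?thesis
      proof (cases "y = m")
        case True
        then show ?thesis using x T'(1) unfolding precedes_split by blast
      next
        case False
        then have "y \<in> T'" using xy 2(1) by simp
        then show ?thesis using T'(3)[OF x _ xy(3)] unfolding precedes_split by blast
      qed
    qed
    ultimately show ?thesis unfolding incs_def by blast
  qed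
qed

lemma card_incs_split:
  assumes "k \<ge> 2" and no: "\<And>T. T \<in> incs k xs \<Longrightarrow> m \<notin> T \<Longrightarrow> T \<inter> set \<alpha> = {} \<or> T \<inter> set \<beta> = {}"
  shows "card (incs k xs) = card (incs k \<alpha>) + card (incs (k - 1) \<alpha>) + card (incs k \<beta>)"
proof -
  have \<alpha>: "T \<subseteq> set \<alpha> \<and> card T = j" if "T \<in> incs j \<alpha>" for T j using that unfolding incs_def by blast
  have \<beta>: "T \<subseteq> set \<beta> \<and> card T = j" if "T \<in> incs j \<beta>" for T j using that unfolding incs_def by blast
  have d1: "incs k \<alpha> \<inter> insert m ` incs (k - 1) \<alpha> = {}" using \<alpha> split_facts(5) by blast
  have d2: "(incs k \<alpha> \<union> insert m ` incs (k - 1) \<alpha>) \<inter> incs k \<beta> = {}"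
  proof -
    have "T \<notin> incs k \<beta>" if "T \<in> incs k \<alpha>" for T
    proof
      assume "T \<in> incs k \<beta>"
      then have "T \<subseteq> set \<alpha> \<inter> set \<beta>" "card T = k" using \<alpha>[OF that] \<beta> by auto
      then show False using split_facts(4) assms(1) by simp
    qed
    moreover have "insert m T \<notin> incs k \<beta>" for T using \<beta> split_facts(6) by blast
    ultimately show ?thesis by blast
  qed
  have "inj_on (insert m) (incs (k - 1) \<alpha>)"
  proof (rule inj_onI)
    fix S T assume ST: "S \<in> incs (k - 1) \<alpha>" "T \<in> incs (k - 1) \<alpha>" "insert m S = insert m T"
    then have "m \<notin> S" "m \<notin> T" using \<alpha> split_facts(5) by blast+
    then show "S = T" using ST(3) by (simp add: insert_ident)
  qed
  then have "card (insert m ` incs (k - 1) \<alpha>) = card (incs (k - 1) \<alpha>)" by (rule card_image)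
  moreover have "incs k xs = incs k \<alpha> \<union> insert m ` incs (k - 1) \<alpha> \<union> incs k \<beta>"
    using assms by (rule incs_split)
  ultimately show ?thesis
    using card_Un_disjoint[OF _ _ d1] card_Un_disjoint[OF _ _ d2] by simp
qed

lemma card_incs_below:
  assumes "k \<ge> 2" "below \<alpha> \<beta>"
  shows "card (incs k xs) = card (incs k \<alpha>) + card (incs (k - 1) \<alpha>) + card (incs k \<beta>)"
proof (rule card_incs_split[OF assms(1)])
  fix T assume T: "T \<in> incs k xs"
  show "T \<inter> set \<alpha> = {} \<or> T \<inter> set \<beta> = {}"
  proof (rule ccontr)
    assume "\<not> ?thesis"
    then obtain x y where xy: "x \<in> T" "x \<in> set \<alpha>" "y \<in> T" "y \<in> set \<beta>" by blast
    then have "y < x" using assms(2) unfolding below_def by blast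
    then have "precedes xs y x" using T xy unfolding incs_def by blast
    moreover have "precedes xs x y" using xy unfolding precedes_split by blast
    ultimately show False using precedes_antisym[OF distinct] by blast
  qed
qed

text \<open>A set meeting both parts lies within the unique ascending pair, so it has at most two
  elements. For \<open>k = 2\<close> that pair would itself be an additional increasing set.\<close>

lemma card_incs_crossed:
  assumes "k \<ge> 3" "crossed \<alpha> \<beta>"
  shows "card (incs k xs) = card (incs k \<alpha>) + card (incs (k - 1) \<alpha>) + card (incs k \<beta>)"
proof (rule card_incs_split)
  show "k \<ge> 2" using assms(1) by simp
  fix T assume T: "T \<in> incs k xs" "m \<notin> T"
  obtain a b where only: "\<And>x y. x \<in> set \<alpha> \<Longrightarrow> y \<in> set \<beta> \<Longrightarrow> x < y \<Longrightarrow> x = a \<and> y = b"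
    using assms(2) unfolding crossed_def by blast
  have ab: "x = a \<and> y = b" if xy: "x \<in> T" "x \<in> set \<alpha>" "y \<in> T" "y \<in> set \<beta>" for x y
  proof -
    have p: "precedes xs x y" using xy unfolding precedes_split by blast
    have "\<not> y < x"
    proof
      assume "y < x"
      then have "precedes xs y x" using T xy unfolding incs_def by blast
      then show False using p precedes_antisym[OF distinct] by blast
    qed
    moreover have "x \<noteq> y" using xy split_facts(4) by blast
    ultimately show ?thesis using only xy by simp
  qed
  show "T \<inter> set \<alpha> = {} \<or> T \<inter> set \<beta> = {}"
  proof (rule ccontr)
    assume "\<not> ?thesis"
    then obtain x y where xy: "x \<in> T" "x \<in> set \<alpha>" "y \<in> T" "y \<in> set \<beta>" by blast
    have "T \<subseteq> set \<alpha> \<union> set \<beta>" using T unfolding incs_def split_facts(1) by auto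
    then have "T \<subseteq> {a, b}" using ab xy by blast
    then have "card T \<le> card {a, b}" by (intro card_mono) auto
    also have "\<dots> \<le> 2" by (simp add: card_insert_if)
    finally show False using T assms(1) unfolding incs_def by simp
  qed
qed

end

text \<open>Deleting two different elements from an increasing set of size \<open>k\<close> gives
  two different ones of size \<open>k - 1\<close>. This eliminates the term for
  \<open>incs k \<alpha>\<close> from the counts of a split.\<close>

lemma incs_Suc_eq_empty:
  assumes "k \<ge> 2" "card (incs (k - 1) xs) \<le> 1"
  shows "incs k xs = {}"
proof (rule ccontr)
  assume "incs k xs \<noteq> {}"
  then obtain T where T: "T \<in> incs k xs" by blast
  then have "finite T" "card T = k" unfolding incs_def using finite_subset by auto
  then obtain x y where xy: "x \<in> T" "y \<in> T" "x \<noteq> y"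
    using assms(1) by (metis One_nat_def Suc_1 card_le_Suc0_iff_eq not_less_eq_eq)
  have mem: "T - {z} \<in> incs (k - 1) xs" if "z \<in> T" for z
    using T that \<open>finite T\<close> unfolding incs_def by auto
  have "{T - {x}, T - {y}} \<subseteq> incs (k - 1) xs" using mem xy by blast
  then have "card {T - {x}, T - {y}} \<le> card (incs (k - 1) xs)"
    by (rule card_mono[OF finite_incs])
  moreover have "T - {x} \<noteq> T - {y}" using xy by blast
  ultimately show False using assms(2) by simp
qed

lemma precedes_trans: "distinct xs \<Longrightarrow> precedes xs x y \<Longrightarrow> precedes xs y z \<Longrightarrow> precedes xs x z"
  by (induction xs) (auto dest: precedes_in_set)

text \<open>Both \<open>a c\<close> and \<open>a b\<close> are increasing pairs. Hence no
  permutation has one 132 and at most one increasing pair, which gives the initial values of C and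
  D.\<close>

lemma card_incs_2_if_occ132:
  assumes "distinct xs" "occ132 xs \<noteq> {}"
  shows "card (incs 2 xs) \<ge> 2"
proof -
  obtain a c b where t: "a < b" "b < c" "precedes xs a c" "precedes xs c b"
    using assms unfolding occ132_def by auto
  have ab: "precedes xs a b" using precedes_trans assms(1) t(3,4) by metis
  have pair: "{x, y} \<in> incs 2 xs" if "x < y" "precedes xs x y" for x y
    using that precedes_in_set[OF that(2)] unfolding incs_def by auto
  have "{{a, c}, {a, b}} \<subseteq> incs 2 xs" using pair[of a c] pair[of a b] t ab by simp
  then have "card {{a, c}, {a, b}} \<le> card (incs 2 xs)" by (rule card_mono[OF finite_incs])
  moreover have "{a, c} \<noteq> {a, b}" using t(1,2) by (auto simp: doubleton_eq_iff)
  ultimately show ?thesis by simp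
qed

subsection \<open>Recurrences\<close>

lemma not_cls_Nil: "\<not> cls c k t []"
  unfolding cls_def by simp

lemma not_joined_singleton:
  assumes "length xs = 1" "\<And>\<alpha> \<beta>. R \<alpha> \<beta> \<Longrightarrow> zigzag \<alpha>"
  shows "\<not> joined R xs"
proof
  assume "joined R xs"
  then obtain \<alpha> m \<beta> where "xs = \<alpha> @ m # \<beta>" "R \<alpha> \<beta>" unfolding joined_def split_max_def by blast
  then show False using assms by fastforce
qed

lemma not_below_crossed: "\<not> (below \<alpha> \<beta> \<and> crossed \<alpha> \<beta>)"
  unfolding below_def crossed_def by (meson less_asym)

text \<open>The single entry stands apart because its parts are empty and thus not
  \<open>zigzag\<close>; having no increasing pair, it counts only for \<open>t = 0\<close>.\<close>

lemma cls_0_iff: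
  assumes "distinct xs" "k \<ge> 2"
  shows "cls 0 k t xs \<longleftrightarrow> t = 0 \<and> length xs = 1 \<or>
    joined (\<lambda>\<alpha> \<beta>. below \<alpha> \<beta> \<and> zigzag \<alpha> \<and> zigzag \<beta> \<and> card (occ132 \<alpha>) = 0 \<and> card (occ132 \<beta>) = 0 \<and>
      card (incs k \<alpha>) + card (incs (k - 1) \<alpha>) + card (incs k \<beta>) = t) xs"
    (is "_ \<longleftrightarrow> _ \<or> joined ?R xs")
proof (cases "length xs = 1")
  case True
  then obtain x where x: "xs = [x]" by (cases xs) auto
  have "occ132 xs = {}" unfolding x occ132_def by simp
  moreover have "incs k xs = {}"
  proof -
    have "card T \<le> 1" if "T \<subseteq> {x}" for T
      using card_mono[OF _ that] by simp
    then show ?thesis using assms(2) unfolding x incs_def by fastforce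
  qed
  moreover have "\<not> joined ?R xs" using True by (rule not_joined_singleton) blast
  ultimately show ?thesis using True unfolding cls_def x by auto
next
  case False
  show ?thesis
  proof (cases "xs = []")
    case True
    then show ?thesis unfolding cls_def joined_def split_max_def by simp
  next
    case ne: False
    obtain \<alpha> m \<beta> where sp: "split_max xs \<alpha> m \<beta>" using split_max_exists[OF assms(1) ne] by blast
    have "cls 0 k t xs \<longleftrightarrow> ?R \<alpha> \<beta>"
    proof
      assume c: "cls 0 k t xs"
      then have b: "below \<alpha> \<beta>" using below_if_no_occ132[OF assms(1) sp] unfolding cls_def by simp
      show "?R \<alpha> \<beta>"
        using c b False zigzag_split_max[OF sp] card_occ132_below[OF assms(1) sp b]
          card_incs_below[OF assms(1) sp assms(2) b]
        unfolding cls_def by simp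
    next
      assume R: "?R \<alpha> \<beta>"
      then have b: "below \<alpha> \<beta>" by blast
      show "cls 0 k t xs"
        using R zigzag_split_max[OF sp] card_occ132_below[OF assms(1) sp b]
          card_incs_below[OF assms(1) sp assms(2) b]
        unfolding cls_def by simp
    qed
    then show ?thesis using False joined_iff[OF sp, of ?R] by simp
  qed
qed

text \<open>A single entry has no 132, so it forms no separate case. As \<open>k >= 3\<close>, the
  \<open>below\<close> and \<open>crossed\<close> cases share one formula for the increasing
  sets.\<close>

lemma cls_1_iff:
  assumes "distinct xs" "k \<ge> 3"
  shows "cls 1 k t xs \<longleftrightarrow> joined (\<lambda>\<alpha> \<beta>. zigzag \<alpha> \<and> zigzag \<beta> \<and>
      (below \<alpha> \<beta> \<and> card (occ132 \<alpha>) + card (occ132 \<beta>) = 1 \<or>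
       crossed \<alpha> \<beta> \<and> card (occ132 \<alpha>) = 0 \<and> card (occ132 \<beta>) = 0) \<and>
      card (incs k \<alpha>) + card (incs (k - 1) \<alpha>) + card (incs k \<beta>) = t) xs"
    (is "_ \<longleftrightarrow> joined ?R xs")
proof (cases "xs = []")
  case True
  then show ?thesis unfolding cls_def joined_def split_max_def by simp
next
  case ne: False
  have k2: "k \<ge> 2" using assms(2) by simp
  obtain \<alpha> m \<beta> where sp: "split_max xs \<alpha> m \<beta>" using split_max_exists[OF assms(1) ne] by blast
  have "cls 1 k t xs \<longleftrightarrow> ?R \<alpha> \<beta>"
  proof
    assume c: "cls 1 k t xs"
    have len: "length xs \<noteq> 1"
    proof
      assume "length xs = 1"
      then obtain x where "xs = [x]" by (cases xs) auto
      then have "occ132 xs = {}" unfolding occ132_def by simp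
      then show False using c unfolding cls_def by simp
    qed
    show "?R \<alpha> \<beta>"
    proof (cases "below \<alpha> \<beta>")
      case True
      then show ?thesis
        using c len zigzag_split_max[OF sp] card_occ132_below[OF assms(1) sp True]
          card_incs_below[OF assms(1) sp k2 True]
        unfolding cls_def by simp
    next
      case False
      then have cr: "crossed \<alpha> \<beta> \<and> occ132 \<alpha> = {} \<and> occ132 \<beta> = {}"
        using c crossed_if_one_occ132[OF assms(1) sp] unfolding cls_def by simp
      then show ?thesis
        using c len zigzag_split_max[OF sp] card_incs_crossed[OF assms(1) sp assms(2)]
        unfolding cls_def by simp
    qed
  next
    assume R: "?R \<alpha> \<beta>"
    show "cls 1 k t xs"
    proof (cases "below \<alpha> \<beta>")
      case True
      then have "\<not> crossed \<alpha> \<beta>" using not_below_crossed by blast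
      then show ?thesis
        using R zigzag_split_max[OF sp] card_occ132_below[OF assms(1) sp True]
          card_incs_below[OF assms(1) sp k2 True]
        unfolding cls_def by simp
    next
      case False
      then have cr: "crossed \<alpha> \<beta>" "zigzag \<alpha>" "occ132 \<alpha> = {}" "occ132 \<beta> = {}" using R by auto
      show ?thesis
        using R zigzag_split_max[OF sp] card_incs_crossed[OF assms(1) sp assms(2) cr(1)]
          card_occ132_crossed[OF assms(1) sp cr]
        unfolding cls_def by simp
    qed
  qed
  then show ?thesis using joined_iff[OF sp, of ?R] by simp
qed

lemma card_incs_sum_eq_0:
  assumes "k \<ge> 2"
  shows "card (incs k \<alpha>) + card (incs (k - 1) \<alpha>) + card (incs k \<beta>) = 0 \<longleftrightarrow>
    card (incs (k - 1) \<alpha>) = 0 \<and> card (incs k \<beta>) = 0"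
proof -
  have "card (incs k \<alpha>) = 0" if "card (incs (k - 1) \<alpha>) = 0"
    using incs_Suc_eq_empty[OF assms, of \<alpha>] that by simp
  then show ?thesis by linarith
qed

text \<open>With at most one increasing set of size \<open>k - 1\<close> in \<alpha> the first
  summand vanishes. The condition becomes two exclusive alternatives, each a condition on \<alpha>
  together with one on \<beta>, as the product rules require.\<close>

lemma card_incs_sum_eq_1:
  assumes "k \<ge> 2"
  shows "card (incs k \<alpha>) + card (incs (k - 1) \<alpha>) + card (incs k \<beta>) = 1 \<longleftrightarrow>
    card (incs (k - 1) \<alpha>) = 1 \<and> card (incs k \<beta>) = 0 \<or> card (incs (k - 1) \<alpha>) = 0 \<and> card (incs k \<beta>) = 1"
proof -
  have "card (incs k \<alpha>) = 0" if "card (incs (k - 1) \<alpha>) \<le> 1"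
    using incs_Suc_eq_empty[OF assms that] by simp
  then show ?thesis by linarith
qed

lemma card_occ132_sum_eq_1:
  "card (occ132 \<alpha>) + card (occ132 \<beta>) = 1 \<longleftrightarrow>
    card (occ132 \<alpha>) = 1 \<and> card (occ132 \<beta>) = 0 \<or> card (occ132 \<alpha>) = 0 \<and> card (occ132 \<beta>) = 1"
  by linarith

lemmas gf_joined_cls =
  gf_joined_below[OF order_invariant_cls order_invariant_cls not_cls_Nil not_cls_Nil]
  gf_joined_crossed[OF order_invariant_cls order_invariant_cls not_cls_Nil not_cls_Nil]

lemma gf_cls_0_0:
  assumes "k \<ge> 2"
  shows "gf (cls 0 k 0) = fps_X + fps_X * (gf (cls 0 (k - 1) 0) * gf (cls 0 k 0))"
proof -
  let ?R = "\<lambda>\<alpha> \<beta>. below \<alpha> \<beta> \<and> cls 0 (k - 1) 0 \<alpha> \<and> cls 0 k 0 \<beta>"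
  have R: "?R = (\<lambda>\<alpha> \<beta>. below \<alpha> \<beta> \<and> zigzag \<alpha> \<and> zigzag \<beta> \<and> card (occ132 \<alpha>) = 0 \<and> card (occ132 \<beta>) = 0 \<and>
      card (incs k \<alpha>) + card (incs (k - 1) \<alpha>) + card (incs k \<beta>) = 0)"
    unfolding card_incs_sum_eq_0[OF assms] cls_def by (intro ext) blast
  have "gf (cls 0 k 0) = gf (\<lambda>xs. length xs = 1 \<or> joined ?R xs)"
    unfolding R by (rule gf_cong) (simp only: cls_0_iff[OF _ assms] simp_thms)
  also have "\<dots> = gf (\<lambda>xs. length xs = 1) + gf (joined ?R)"
  proof (rule gf_or)
    fix xs :: "nat list"
    show "\<not> (length xs = 1 \<and> joined ?R xs)"
      using not_joined_singleton[of xs ?R] unfolding cls_def by blast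
  qed
  finally show ?thesis unfolding gf_singleton gf_joined_cls .
qed

lemma gf_cls_0_1:
  assumes "k \<ge> 2"
  shows "gf (cls 0 k 1) = fps_X * (gf (cls 0 (k - 1) 1) * gf (cls 0 k 0))
    + fps_X * (gf (cls 0 (k - 1) 0) * gf (cls 0 k 1))"
proof -
  let ?R = "\<lambda>\<alpha> \<beta>. below \<alpha> \<beta> \<and> cls 0 (k - 1) 1 \<alpha> \<and> cls 0 k 0 \<beta> \<or>
    below \<alpha> \<beta> \<and> cls 0 (k - 1) 0 \<alpha> \<and> cls 0 k 1 \<beta>"
  have R: "?R = (\<lambda>\<alpha> \<beta>. below \<alpha> \<beta> \<and> zigzag \<alpha> \<and> zigzag \<beta> \<and> card (occ132 \<alpha>) = 0 \<and> card (occ132 \<beta>) = 0 \<and>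
      card (incs k \<alpha>) + card (incs (k - 1) \<alpha>) + card (incs k \<beta>) = 1)"
    unfolding card_incs_sum_eq_1[OF assms] cls_def by (intro ext) blast
  have "gf (cls 0 k 1) = gf (joined ?R)"
    unfolding R by (rule gf_cong) (simp only: cls_0_iff[OF _ assms] one_neq_zero simp_thms)
  also have "\<dots> = gf (joined (\<lambda>\<alpha> \<beta>. below \<alpha> \<beta> \<and> cls 0 (k - 1) 1 \<alpha> \<and> cls 0 k 0 \<beta>))
    + gf (joined (\<lambda>\<alpha> \<beta>. below \<alpha> \<beta> \<and> cls 0 (k - 1) 0 \<alpha> \<and> cls 0 k 1 \<beta>))"
    by (rule gf_joined_or) (simp add: cls_def)
  finally show ?thesis unfolding gf_joined_cls .
qed

lemma gf_cls_1_0: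
  assumes "k \<ge> 3"
  shows "gf (cls 1 k 0) = fps_X * (gf (cls 1 (k - 1) 0) * gf (cls 0 k 0))
    + (fps_X * (gf (cls 0 (k - 1) 0) * gf (cls 1 k 0))
    + fps_X * (gf (cls 0 (k - 1) 0) * gf (cls 0 k 0)))"
proof -
  have k2: "k \<ge> 2" using assms by simp
  let ?R1 = "\<lambda>\<alpha> \<beta>. below \<alpha> \<beta> \<and> cls 1 (k - 1) 0 \<alpha> \<and> cls 0 k 0 \<beta>"
  let ?R2 = "\<lambda>\<alpha> \<beta>. below \<alpha> \<beta> \<and> cls 0 (k - 1) 0 \<alpha> \<and> cls 1 k 0 \<beta>"
  let ?R3 = "\<lambda>\<alpha> \<beta>. crossed \<alpha> \<beta> \<and> cls 0 (k - 1) 0 \<alpha> \<and> cls 0 k 0 \<beta>"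
  let ?R = "\<lambda>\<alpha> \<beta>. ?R1 \<alpha> \<beta> \<or> ?R2 \<alpha> \<beta> \<or> ?R3 \<alpha> \<beta>"
  have R: "?R = (\<lambda>\<alpha> \<beta>. zigzag \<alpha> \<and> zigzag \<beta> \<and>
      (below \<alpha> \<beta> \<and> card (occ132 \<alpha>) + card (occ132 \<beta>) = 1 \<or>
       crossed \<alpha> \<beta> \<and> card (occ132 \<alpha>) = 0 \<and> card (occ132 \<beta>) = 0) \<and>
      card (incs k \<alpha>) + card (incs (k - 1) \<alpha>) + card (incs k \<beta>) = 0)"
    unfolding card_incs_sum_eq_0[OF k2] cls_def card_occ132_sum_eq_1 by (intro ext) argo
  have "gf (cls 1 k 0) = gf (joined ?R)"
    unfolding R by (rule gf_cong) (rule cls_1_iff[OF _ assms])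
  also have "\<dots> = gf (joined ?R1) + gf (joined (\<lambda>\<alpha> \<beta>. ?R2 \<alpha> \<beta> \<or> ?R3 \<alpha> \<beta>))"
    by (rule gf_joined_or) (use not_below_crossed in \<open>auto simp: cls_def\<close>)
  also have "gf (joined (\<lambda>\<alpha> \<beta>. ?R2 \<alpha> \<beta> \<or> ?R3 \<alpha> \<beta>)) = gf (joined ?R2) + gf (joined ?R3)"
    by (rule gf_joined_or) (use not_below_crossed in \<open>auto simp: cls_def\<close>)
  finally show ?thesis unfolding gf_joined_cls .
qed

text \<open>The 132 lies left, right or across the maximum, and the increasing subsequence lies in
  the left part extended by the maximum or in the right part: six products. The last two together
  equal \<open>gf (cls 0 k 1)\<close> by \<open>gf_cls_0_1\<close>.\<close>

lemma gf_cls_1_1: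
  assumes "k \<ge> 3"
  shows "gf (cls 1 k 1) = fps_X * (gf (cls 1 (k - 1) 1) * gf (cls 0 k 0))
    + (fps_X * (gf (cls 0 (k - 1) 1) * gf (cls 1 k 0))
    + (fps_X * (gf (cls 1 (k - 1) 0) * gf (cls 0 k 1))
    + (fps_X * (gf (cls 0 (k - 1) 0) * gf (cls 1 k 1))
    + (fps_X * (gf (cls 0 (k - 1) 1) * gf (cls 0 k 0))
    + fps_X * (gf (cls 0 (k - 1) 0) * gf (cls 0 k 1))))))"
proof -
  have k2: "k \<ge> 2" using assms by simp
  let ?R1 = "\<lambda>\<alpha> \<beta>. below \<alpha> \<beta> \<and> cls 1 (k - 1) 1 \<alpha> \<and> cls 0 k 0 \<beta>"
  let ?R2 = "\<lambda>\<alpha> \<beta>. below \<alpha> \<beta> \<and> cls 0 (k - 1) 1 \<alpha> \<and> cls 1 k 0 \<beta>"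
  let ?R3 = "\<lambda>\<alpha> \<beta>. below \<alpha> \<beta> \<and> cls 1 (k - 1) 0 \<alpha> \<and> cls 0 k 1 \<beta>"
  let ?R4 = "\<lambda>\<alpha> \<beta>. below \<alpha> \<beta> \<and> cls 0 (k - 1) 0 \<alpha> \<and> cls 1 k 1 \<beta>"
  let ?R5 = "\<lambda>\<alpha> \<beta>. crossed \<alpha> \<beta> \<and> cls 0 (k - 1) 1 \<alpha> \<and> cls 0 k 0 \<beta>"
  let ?R6 = "\<lambda>\<alpha> \<beta>. crossed \<alpha> \<beta> \<and> cls 0 (k - 1) 0 \<alpha> \<and> cls 0 k 1 \<beta>"
  let ?Q5 = "\<lambda>\<alpha> \<beta>. ?R5 \<alpha> \<beta> \<or> ?R6 \<alpha> \<beta>"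
  let ?Q4 = "\<lambda>\<alpha> \<beta>. ?R4 \<alpha> \<beta> \<or> ?Q5 \<alpha> \<beta>"
  let ?Q3 = "\<lambda>\<alpha> \<beta>. ?R3 \<alpha> \<beta> \<or> ?Q4 \<alpha> \<beta>"
  let ?Q2 = "\<lambda>\<alpha> \<beta>. ?R2 \<alpha> \<beta> \<or> ?Q3 \<alpha> \<beta>"
  let ?R = "\<lambda>\<alpha> \<beta>. ?R1 \<alpha> \<beta> \<or> ?Q2 \<alpha> \<beta>"
  have R: "?R = (\<lambda>\<alpha> \<beta>. zigzag \<alpha> \<and> zigzag \<beta> \<and>
      (below \<alpha> \<beta> \<and> card (occ132 \<alpha>) + card (occ132 \<beta>) = 1 \<or>
       crossed \<alpha> \<beta> \<and> card (occ132 \<alpha>) = 0 \<and> card (occ132 \<beta>) = 0) \<and>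
      card (incs k \<alpha>) + card (incs (k - 1) \<alpha>) + card (incs k \<beta>) = 1)"
    unfolding card_incs_sum_eq_1[OF k2] cls_def card_occ132_sum_eq_1 by (intro ext) argo
  have "gf (cls 1 k 1) = gf (joined ?R)"
    unfolding R by (rule gf_cong) (rule cls_1_iff[OF _ assms])
  also have "\<dots> = gf (joined ?R1) + gf (joined ?Q2)"
    by (rule gf_joined_or) (use not_below_crossed in \<open>auto simp: cls_def\<close>)
  also have "gf (joined ?Q2) = gf (joined ?R2) + gf (joined ?Q3)"
    by (rule gf_joined_or) (use not_below_crossed in \<open>auto simp: cls_def\<close>)
  also have "gf (joined ?Q3) = gf (joined ?R3) + gf (joined ?Q4)"
    by (rule gf_joined_or) (use not_below_crossed in \<open>auto simp: cls_def\<close>)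
  also have "gf (joined ?Q4) = gf (joined ?R4) + gf (joined ?Q5)"
    by (rule gf_joined_or) (use not_below_crossed in \<open>auto simp: cls_def\<close>)
  also have "gf (joined ?Q5) = gf (joined ?R5) + gf (joined ?R6)"
    by (rule gf_joined_or) (use not_below_crossed in \<open>auto simp: cls_def\<close>)
  finally show ?thesis unfolding gf_joined_cls .
qed

section \<open>Initial values and the link with the counting function\<close>

lemma card_incs_1: "card (incs 1 xs) = card (set xs)"
proof -
  have "incs 1 xs = (\<lambda>x. {x}) ` set xs"
    unfolding incs_def by (auto simp: card_1_singleton_iff)
  then show ?thesis by (simp add: card_image)
qed

text \<open>A and B start at \<open>k = 1\<close>, where increasing sets are single entries; C and D
  start at \<open>k = 2\<close>, since their recurrences are stated for
  \<open>k >= 3\<close>.\<close>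

lemma gf_base:
  "gf (cls 0 1 0) = 0" "gf (cls 0 1 1) = fps_X" "gf (cls 1 2 0) = 0" "gf (cls 1 2 1) = 0"
proof -
  show "gf (cls 0 1 0) = 0"
    by (rule gf_False) (auto simp only: cls_def card_incs_1 card_0_eq finite_set set_empty zigzag.simps)
  have "cls 0 1 1 xs \<longleftrightarrow> length xs = 1" if "distinct xs" for xs
  proof
    assume "cls 0 1 1 xs"
    then show "length xs = 1"
      using distinct_card[OF that] unfolding cls_def card_incs_1 by simp
  next
    assume "length xs = 1"
    then obtain x where "xs = [x]" by (cases xs) auto
    moreover have "occ132 [x] = {}" unfolding occ132_def by simp
    ultimately show "cls 0 1 1 xs" unfolding cls_def card_incs_1 by simp
  qed
  then show "gf (cls 0 1 1) = fps_X" unfolding gf_singleton[symmetric] by (rule gf_cong)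
  have "\<not> cls 1 2 t xs" if "distinct xs" "t \<le> 1" for t xs
  proof
    assume "cls 1 2 t xs"
    then have c: "card (occ132 xs) = 1" "card (incs 2 xs) = t" unfolding cls_def by blast+
    then have "occ132 xs \<noteq> {}" by auto
    then show False using card_incs_2_if_occ132[OF that(1)] that(2) c(2) by simp
  qed
  then show "gf (cls 1 2 0) = 0" "gf (cls 1 2 1) = 0" by (intro gf_False; simp)+
qed

text \<open>\<open>zigzag\<close> differs from \<open>up_down\<close> only in admitting length 1,
  and a word of length 1 contains no 132.\<close>

lemma gf_cls_1_1_eq_ud: "gf (cls 1 k 1) = Abs_fps (\<lambda>n. of_nat (ud k n))"
proof -
  have "ud k n = num_perms (cls 1 k 1) {1..n}" for n
  proof -
    have "up_down xs \<and> contains_once [1, 3, 2] xs \<and> contains_once [1..<k + 1] xs \<longleftrightarrow> cls 1 k 1 xs"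
      if "xs \<in> permutations_of_set {1..n}" for xs
    proof -
      have d: "distinct xs" using that by (rule permutations_of_setD)
      have "length xs \<ge> 3" if "zigzag xs" "card (occ132 xs) = 1"
      proof -
        have "length xs \<noteq> 1"
        proof
          assume "length xs = 1"
          then obtain x where "xs = [x]" by (cases xs) auto
          then have "occ132 xs = {}" unfolding occ132_def by simp
          then show False using that(2) by simp
        qed
        then show ?thesis using zigzag_length[OF that(1)] by presburger
      qed
      then show ?thesis
        unfolding contains_once_def card_occurrences_132[OF d] card_occurrences_increasing[OF d]
          up_down_iff cls_def by blast
    qed
    then show ?thesis unfolding ud_def num_perms_def by (intro arg_cong[of _ _ card] Collect_cong conj_cong refl)
  qed
  moreover have "num_perms (cls 1 k 1) {1..n} = num_perms (cls 1 k 1) {..<n}" for n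
    using num_perms_card[OF order_invariant_cls, of "{1..n}"] by simp
  ultimately show ?thesis unfolding gf_def by simp
qed

subsection \<open>Solving the recurrences\<close>

text \<open>The index is shifted: \<open>a r\<close>, \<open>b r\<close>, \<open>c r\<close>, \<open>d r\<close> stand for the series A, B, C, D with \<open>k = r + 1\<close>.\<close>

context
  fixes x :: "'a::field" and u a b c d :: "nat \<Rightarrow> 'a"
  assumes x: "x \<noteq> 0"
    and u: "u 0 = 1" "x * u 1 = 1" "\<And>r. x * u (Suc (Suc r)) = u (Suc r) - x * u r"
    and base: "a 0 = 0" "b 0 = x" "c 1 = 0" "d 1 = 0"
    and a_rec: "\<And>r. a (Suc r) = x + x * (a r * a (Suc r))"
    and b_rec: "\<And>r. b (Suc r) = x * (b r * a (Suc r)) + x * (a r * b (Suc r))"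
    and c_rec: "\<And>r. r \<ge> 1 \<Longrightarrow> c (Suc r) = x * (c r * a (Suc r))
      + (x * (a r * c (Suc r)) + x * (a r * a (Suc r)))"
    and d_rec: "\<And>r. r \<ge> 1 \<Longrightarrow> d (Suc r) = x * (d r * a (Suc r)) + (x * (b r * c (Suc r))
      + (x * (c r * b (Suc r)) + (x * (a r * d (Suc r))
      + (x * (b r * a (Suc r)) + x * (a r * b (Suc r))))))"
begin

text \<open>Since \<open>a (Suc r)\<close> is \<open>x / (1 - x a r)\<close>, it solves every linear equation with that coefficient.\<close>

lemma solve_linear:
  assumes "y = x * z + x * (a r * y)"
  shows "y = a (Suc r) * z"
proof -
  have "a (Suc r) * y = (x + x * (a r * a (Suc r))) * y" by (subst a_rec) (rule refl)
  then have "x * y = a (Suc r) * (y - x * (a r * y))" by (simp add: algebra_simps)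
  also have "y - x * (a r * y) = x * z" using assms by (simp only: diff_eq_eq)
  finally have "x * y = x * (a (Suc r) * z)" by (simp add: algebra_simps)
  then show ?thesis using x by simp
qed

text \<open>The recurrence of \<open>u\<close>, with \<open>u r\<close> replaced by
  \<open>a (Suc r) * u (Suc r)\<close>, is an instance of \<open>solve_linear\<close> with
  \<open>y = u (Suc r)\<close> and \<open>z = u (Suc (Suc r))\<close>. Nonvanishing is carried along
  because the resulting equation passes it from \<open>y\<close> to \<open>z\<close>.\<close>

lemma a_eq: "u (Suc r) \<noteq> 0 \<and> a (Suc r) = u r / u (Suc r)"
proof (induction r)
  case 0
  have "a 1 = x" using a_rec[of 0] base(1) by simp
  moreover have "u 1 \<noteq> 0" using u(2) by auto
  ultimately show ?case using u(1,2) by (simp add: eq_divide_eq)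
next
  case (Suc r)
  have "u r = a (Suc r) * u (Suc r)" using Suc by simp
  then have "x * u (Suc (Suc r)) = u (Suc r) - x * (a (Suc r) * u (Suc r))" using u(3)[of r] by simp
  then have "u (Suc r) = x * u (Suc (Suc r)) + x * (a (Suc r) * u (Suc r))" by simp
  then have eq: "u (Suc r) = a (Suc (Suc r)) * u (Suc (Suc r))" by (rule solve_linear)
  then have "u (Suc (Suc r)) \<noteq> 0" using Suc by auto
  then show ?case using eq by (simp add: eq_divide_eq)
qed

lemma u_nonzero: "u r \<noteq> 0"
  using a_eq u(1) by (cases r) simp_all

text \<open>Each step multiplies by \<open>(a (Suc r))\<^sup>2\<close>, and the quotients of
  consecutive \<open>u\<close> telescope.\<close>

lemma b_eq: "b r = x / (u r)\<^sup>2"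
proof (induction r)
  case 0
  then show ?case using base(2) u(1) by simp
next
  case (Suc r)
  have "b (Suc r) = a (Suc r) * (b r * a (Suc r))" using b_rec by (rule solve_linear)
  also have "\<dots> = x / (u (Suc r))\<^sup>2"
    using a_eq[of r] Suc u_nonzero[of r] by (simp add: power2_eq_square)
  finally show ?case .
qed

text \<open>After multiplication by the squared \<open>u\<close> of the same index, the recurrence
  only adds \<open>u r * u (Suc r)\<close> at each step.\<close>

lemma c_eq: "c (Suc r) = (\<Sum>i<r. u i * u (i + 1)) / (u (Suc r))\<^sup>2"
proof (induction r)
  case 0
  then show ?case using base(3) by simp
next
  case (Suc r)
  have "c (Suc (Suc r)) = x * (c (Suc r) * a (Suc (Suc r)) + a (Suc r) * a (Suc (Suc r)))
      + x * (a (Suc r) * c (Suc (Suc r)))"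
    using c_rec[of "Suc r"] by (simp only: distrib_left add_ac)
  then have "c (Suc (Suc r)) = a (Suc (Suc r)) * (c (Suc r) * a (Suc (Suc r)) + a (Suc r) * a (Suc (Suc r)))"
    by (rule solve_linear)
  also have "\<dots> = (c (Suc r) + a (Suc r)) * (a (Suc (Suc r)))\<^sup>2"
    by (simp add: algebra_simps power2_eq_square)
  also have "\<dots> = ((\<Sum>i<r. u i * u (i + 1)) + u r * u (Suc r)) / (u (Suc (Suc r)))\<^sup>2"
    using u_nonzero[of "Suc r"] u_nonzero[of "Suc (Suc r)"]
    unfolding Suc a_eq[THEN conjunct2] by (simp add: field_simps power2_eq_square)
  finally show ?case by simp
qed

text \<open>After multiplication by the squared \<open>u\<close> of the same index, each step adds
  one summand. In the notation of the proof, the two products of B with C put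
  \<open>2 * x * S\<close> into its numerator, the extra term of the later C puts in
  \<open>x * u r * w\<close>, and the B left over from the crossed case puts in
  \<open>w\<^sup>2\<close>.\<close>

lemma d_eq:
  "d (Suc r) = 1 / (u (Suc r))\<^sup>2 * (\<Sum>j<r.
     (u (j + 1) * (u (j + 1) + x * u j) + 2 * x * (\<Sum>i<j. u i * u (i + 1))) / (u (j + 1) * u (j + 2)))"
    (is "_ = _ * (\<Sum>j<r. ?t j)")
proof (induction r)
  case 0
  then show ?case using base(4) by simp
next
  case (Suc r)
  define v w where "v = u (Suc (Suc r))" and "w = u (Suc r)"
  define S D where "S = (\<Sum>i<r. u i * u (i + 1))" and "D = (\<Sum>j<r. ?t j)"
  have nz: "v \<noteq> 0" "w \<noteq> 0" unfolding v_def w_def by (rule u_nonzero)+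
  have a2: "a (Suc (Suc r)) = w / v" using a_eq[of "Suc r"] unfolding v_def w_def by blast
  have b1: "b (Suc r) = x / w\<^sup>2" and b2: "b (Suc (Suc r)) = x / v\<^sup>2"
    unfolding v_def w_def by (rule b_eq)+
  have c1: "c (Suc r) = S / w\<^sup>2" unfolding w_def S_def by (rule c_eq)
  have c2: "c (Suc (Suc r)) = (S + u r * w) / v\<^sup>2"
    unfolding c_eq v_def w_def S_def by simp
  have d1: "d (Suc r) = 1 / w\<^sup>2 * D" unfolding w_def D_def by (rule Suc)
  \<comment> \<open>The last two summands of \<open>d_rec\<close> are \<open>b (Suc (Suc r))\<close>
    by \<open>b_rec\<close>; dividing it by \<open>x\<close> brings the equation into the form
    required by \<open>solve_linear\<close>.\<close>
  let ?z = "d (Suc r) * a (Suc (Suc r)) + b (Suc r) * c (Suc (Suc r))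
      + c (Suc r) * b (Suc (Suc r)) + b (Suc (Suc r)) / x"
  have "d (Suc (Suc r)) = x * (d (Suc r) * a (Suc (Suc r))) + (x * (b (Suc r) * c (Suc (Suc r)))
      + (x * (c (Suc r) * b (Suc (Suc r))) + (x * (a (Suc r) * d (Suc (Suc r))) + b (Suc (Suc r)))))"
    using d_rec[of "Suc r"] unfolding b_rec[of "Suc r", symmetric] by simp
  also have "\<dots> = x * ?z + x * (a (Suc r) * d (Suc (Suc r)))"
    using x by (simp add: distrib_left)
  finally have "d (Suc (Suc r)) = a (Suc (Suc r)) * ?z" by (rule solve_linear)
  also have "\<dots> = w / v * (1 / w\<^sup>2 * D * (w / v) + x / w\<^sup>2 * ((S + u r * w) / v\<^sup>2)
      + S / w\<^sup>2 * (x / v\<^sup>2) + x / v\<^sup>2 / x)"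
    unfolding a2 b1 b2 c1 c2 d1 ..
  also have "\<dots> = 1 / v\<^sup>2 * (D + (w * (w + x * u r) + 2 * x * S) / (w * v))"
    using nz x by (simp add: field_simps power2_eq_square)
  finally show ?case unfolding v_def w_def S_def D_def by simp
qed

end

text \<open>At t = 1/(2x) the factor 2t is 1/x, so multiplying the Chebyshev recurrence by x gives
  the division-free form assumed for \<open>u\<close>.\<close>

lemma U_simps:
  "U 0 = 1" "fls_X * U 1 = 1" "fls_X * U (Suc (Suc r)) = U (Suc r) - fls_X * U r"
proof -
  define h :: "rat fls" where "h = 1 / (2 * fls_X)"
  have "2 * fls_X \<noteq> (0 :: rat fls)" by simp
  then have "h * (2 * fls_X) = 1" using nonzero_eq_divide_eq[of "2 * fls_X" h 1] h_def by blast
  then have h: "fls_X * (2 * h) = 1" by (simp only: ac_simps)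
  have U: "U n = poly (chebyshev_U n) h" for n unfolding U_def h_def ..
  show "U 0 = 1" "fls_X * U 1 = 1" unfolding U using h by (simp_all add: mult.commute)
  have "U (Suc (Suc r)) = 2 * h * U (Suc r) - U r" unfolding U by (simp add: mult.commute)
  then have "fls_X * U (Suc (Suc r)) = fls_X * (2 * h) * U (Suc r) - fls_X * U r"
    by (simp only: right_diff_distrib mult.assoc)
  then show "fls_X * U (Suc (Suc r)) = U (Suc r) - fls_X * U r" unfolding h by simp
qed

theorem theorem5p1:
  fixes k :: nat
  assumes "k \<ge> 2"
  shows "fps_to_fls (Abs_fps (\<lambda>n. of_nat (ud k n))) =
    1 / (U (k - 1))\<^sup>2 *
    (\<Sum>j<k - 2.
       (U (j + 1) * (U (j + 1) + fls_X * U j) + 2 * fls_X * (\<Sum>i<j. U i * U (i + 1)))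
       / (U (j + 1) * U (j + 2)))"
proof -
  \<comment> \<open>The series are moved to Laurent series, where \<open>U\<close> lives, with
    \<open>r\<close> standing for \<open>k = r + 1\<close>; the recurrences for
    \<open>k >= 3\<close> thus apply from \<open>r = 1\<close> on.\<close>
  define g where "g c t r = fps_to_fls (gf (cls c (Suc r) t))" for c t r
  note hom = fps_to_fls_plus fls_times_fps_to_fls fps_X_to_fls
  have idx: "Suc r - 1 = r" "2 \<le> Suc (Suc r)" "r \<ge> 1 \<Longrightarrow> 3 \<le> Suc (Suc r)" for r :: nat by simp_all
  have base: "g 0 0 0 = 0" "g 0 1 0 = fls_X" "g 1 0 1 = 0" "g 1 1 1 = 0"
    using gf_base unfolding g_def by (simp_all add: numeral_2_eq_2)
  have a: "g 0 0 (Suc r) = fls_X + fls_X * (g 0 0 r * g 0 0 (Suc r))" for r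
    using arg_cong[OF gf_cls_0_0[OF idx(2)[of r]], of fps_to_fls] unfolding g_def hom idx(1) .
  have b: "g 0 1 (Suc r) = fls_X * (g 0 1 r * g 0 0 (Suc r)) + fls_X * (g 0 0 r * g 0 1 (Suc r))" for r
    using arg_cong[OF gf_cls_0_1[OF idx(2)[of r]], of fps_to_fls] unfolding g_def hom idx(1) .
  have c: "g 1 0 (Suc r) = fls_X * (g 1 0 r * g 0 0 (Suc r))
      + (fls_X * (g 0 0 r * g 1 0 (Suc r)) + fls_X * (g 0 0 r * g 0 0 (Suc r)))" if "r \<ge> 1" for r
    using arg_cong[OF gf_cls_1_0[OF idx(3)[OF that]], of fps_to_fls] unfolding g_def hom idx(1) .
  have d: "g 1 1 (Suc r) = fls_X * (g 1 1 r * g 0 0 (Suc r)) + (fls_X * (g 0 1 r * g 1 0 (Suc r))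
      + (fls_X * (g 1 0 r * g 0 1 (Suc r)) + (fls_X * (g 0 0 r * g 1 1 (Suc r))
      + (fls_X * (g 0 1 r * g 0 0 (Suc r)) + fls_X * (g 0 0 r * g 0 1 (Suc r))))))" if "r \<ge> 1" for r
    using arg_cong[OF gf_cls_1_1[OF idx(3)[OF that]], of fps_to_fls] unfolding g_def hom idx(1) .
  \<comment> \<open>The solution is read at \<open>r = k - 2\<close>, where
    \<open>Suc (Suc r)\<close> is \<open>k\<close>; for \<open>k = 2\<close> this is the initial
    value and the sum is empty.\<close>
  have k: "Suc (k - 2) = k - 1" "Suc (k - 1) = k" using assms by simp_all
  have "fps_to_fls (Abs_fps (\<lambda>n. of_nat (ud k n))) = g 1 1 (Suc (k - 2))"
    unfolding g_def k gf_cls_1_1_eq_ud ..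
  then show ?thesis
    using d_eq[OF _ U_simps base a b c d, of "k - 2"] unfolding k by simp
qed

end
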